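(* Let $h\in\Sigma[1]$. The following assertions are equivalent: (i) $h\in\Sigma_A^0[1]$, i.e., the angular limit $\mu=\angle\lim_{z\to1}(1-z)h'(z)$ exists finitely; (ii) $h(\Delta)$ lies in a horizontal strip; (iii) $h$ is a Bloch function, i.e., $\|h\|_B:=\sup_{z\in\Delta}(1-|z|^2)|h'(z)|<\infty$. Moreover, in this case: (a) the smallest horizontal strip which contains $h(\Delta)$ is $$\left\{w\in\mathbb{C}:|\operatorname{Im}w-a|<\frac{\pi\mu}{2}\right\},\qquad\text{where } a=\lim_{r\to1^-}\operatorname{Im}h(r);$$ (b) $2|\mu|\le\|h\|_B\le4|\mu|$.
   Context: $\Delta$ is the open unit disk in $\mathbb{C}$. $\Sigma[1]$ is the class of univalent holomorphic functions $h:\Delta\to\mathbb{C}$ such that $h(0)=0$, $h(z)+t\in h(\Delta)$ for all $z\in\Delta$, $t\ge0$, and $\lim_{t\to\infty}h^{-1}(h(z)+t)=1$ for all $z\in\Delta$. $\angle\lim_{z\to1}$ denotes the angular (nontangential) limit at $1$. A horizontal strip is a set of the form $\{w: c_1<\operatorname{Im}w<c_2\}$ with $c_1,c_2$ finite. *)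

theory Defs
  imports "HOL-Complex_Analysis.Complex_Analysis" "HOL-Library.Extended_Real"
begin

abbreviation unit_disk :: "complex set"
  where "unit_disk \<equiv> ball 0 1"

text \<open>
  The inverse of a univalent function is taken on its image of the disk, as \<open>inv_into unit_disk h\<close>;
  values of \<open>h\<close> outside the disk play no role.
\<close>

definition Sigma_1 :: "(complex \<Rightarrow> complex) set" where
  "Sigma_1 = {h. h holomorphic_on unit_disk \<and> inj_on h unit_disk \<and> h 0 = 0 \<and>
     (\<forall>z\<in>unit_disk. \<forall>t::real. t \<ge> 0 \<longrightarrow> h z + of_real t \<in> h ` unit_disk) \<and>
     (\<forall>z\<in>unit_disk.
        ((\<lambda>t::real. inv_into unit_disk h (h z + of_real t)) \<longlongrightarrow> 1) at_top)}"

definition nontangential_region :: "complex \<Rightarrow> real \<Rightarrow> complex set" where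
  "nontangential_region \<zeta> M = {z\<in>unit_disk. norm (\<zeta> - z) < M * (1 - norm z)}"

text \<open>For \<open>\<zeta>\<close> on the unit circle the regions are nonempty exactly when \<open>M > 1\<close>.\<close>

definition has_angular_limit ::
    "(complex \<Rightarrow> complex) \<Rightarrow> complex \<Rightarrow> complex \<Rightarrow> bool" where
  "has_angular_limit f \<zeta> L \<longleftrightarrow>
     (\<forall>M>1. (f \<longlongrightarrow> L) (at \<zeta> within nontangential_region \<zeta> M))"

definition Sigma_A0_1 :: "(complex \<Rightarrow> complex) set" where
  "Sigma_A0_1 = {h\<in>Sigma_1. \<exists>\<mu>. has_angular_limit (\<lambda>z. (1 - z) * deriv h z) 1 \<mu>}"

definition horizontal_strip :: "complex set \<Rightarrow> bool" where
  "horizontal_strip S \<longleftrightarrow> (\<exists>c1 c2::real. S = {w. c1 < Im w \<and> Im w < c2})"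

definition smallest_horizontal_strip_containing :: "complex set \<Rightarrow> complex set \<Rightarrow> bool" where
  "smallest_horizontal_strip_containing A S \<longleftrightarrow>
     horizontal_strip S \<and> A \<subseteq> S \<and> (\<forall>T. horizontal_strip T \<and> A \<subseteq> T \<longrightarrow> S \<subseteq> T)"

text \<open>Extended-real valued, so that the supremum is meaningful also when it is infinite.\<close>

definition bloch_seminorm :: "(complex \<Rightarrow> complex) \<Rightarrow> ereal" where
  "bloch_seminorm h = (SUP z\<in>unit_disk. ereal ((1 - (norm z)\<^sup>2) * norm (deriv h z)))"

definition bloch_function :: "(complex \<Rightarrow> complex) \<Rightarrow> bool" where
  "bloch_function h \<longleftrightarrow> h holomorphic_on unit_disk \<and> bloch_seminorm h < \<infinity>"

end

theory Submission
  imports Defs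
begin

text \<open>
  The Cayley transform moves the disk to the right half-plane \<open>H\<close> and the point 1 to infinity;
  let \<open>g\<close> be the transported map. Then \<open>\<phi>\<^sub>t = g\<inverse> \<circ> (g + t)\<close> is a semigroup of self-maps of \<open>H\<close>
  escaping to infinity, so \<open>Re \<phi>\<^sub>t \<ge> Re\<close> by Wolff's lemma and the vector field \<open>p = 1 / g'\<close> has
  nonnegative real part. By the Julia--Wolff--Caratheodory theorem \<open>p w / w\<close> has the
  nontangential limit \<open>c = inf (Re p / Re)\<close> at infinity, and \<open>(1 - z) h' z = (w + 1) g' w\<close>. Hence
  (i) amounts to \<open>c > 0\<close> with \<open>\<mu> = 1 / c\<close>, and since the Bloch seminorm is \<open>sup (2 Re w |g' w|)\<close>,
  it is then equal to \<open>2 \<mu>\<close>.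

  A map into a strip is Bloch by the Schwarz--Pick lemma. Conversely, if \<open>c > 0\<close>, each trajectory of
  \<open>\<phi>\<close> stays in a sector, \<open>Im g\<close> is constant along it, and \<open>Im g (R e\<^sup>i\<^sup>\<alpha>) - Im g R\<close> tends to \<open>\<mu> \<alpha>\<close> as
  \<open>R\<close> grows; as \<open>\<alpha>\<close> ranges over \<open>(-\<pi>/2, \<pi>/2)\<close>, this gives both the strip and its width.
\<close>

section \<open>Schwarz--Pick on the right half-plane\<close>

definition half_plane :: "complex set"
  where "half_plane = {w. 0 < Re w}"

lemma half_plane_iff: "w \<in> half_plane \<longleftrightarrow> 0 < Re w"
  by (simp add: half_plane_def)

lemma open_half_plane: "open half_plane"
  by (simp add: half_plane_def open_halfspace_Re_gt)

text \<open>For \<open>x\<close>, \<open>y\<close> in the half-plane, division by the left-hand side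
  shows that the pseudo-hyperbolic distance |x - y| / |x + cnj y| is less than 1. The identity
  trades this distance for the product of the real parts.\<close>

lemma cmod_add_cnj_power2:
  "(cmod (x + cnj y))\<^sup>2 = (cmod (x - y))\<^sup>2 + 4 * Re x * Re y"
  by (simp add: cmod_power2) (simp add: power2_eq_square algebra_simps)

lemma add_cnj_nonzero:
  assumes "0 < Re x" "0 \<le> Re y"
  shows "x + cnj y \<noteq> 0"
proof -
  have "Re (x + cnj y) > 0" using assms by simp
  then show ?thesis by (metis less_irrefl zero_complex.simps(1))
qed

text \<open>Moebius maps sending \<open>a\<close> and \<open>f a\<close> to 0 turn \<open>f\<close>
  into a self-map of the disk fixing 0, to which the Schwarz lemma applies. Stated without
  quotients, the inequality is easy to square and to pass to limits.\<close>

lemma Schwarz_Pick_half_plane: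
  assumes f: "f holomorphic_on half_plane"
    and pos: "\<And>w. w \<in> half_plane \<Longrightarrow> 0 < Re (f w)"
    and w: "w \<in> half_plane" and a: "a \<in> half_plane"
  shows "cmod (f w - f a) * cmod (w + cnj a) \<le> cmod (f w + cnj (f a)) * cmod (w - a)"
proof -
  \<comment> \<open>\<open>M\<close> is the inverse of the map w to (w - a) / (w + cnj a); it sends
    0 to \<open>a\<close> and the disk into the half-plane.\<close>
  define M where "M = (\<lambda>z. (a + cnj a * z) / (1 - z))"
  define \<psi> where "\<psi> = (\<lambda>z. (f (M z) - f a) / (f (M z) + cnj (f a)))"
  have Rea: "Re a > 0" and Rew: "Re w > 0"
    using a w by (auto simp: half_plane_iff)
  have M_pos: "M z \<in> half_plane" if "cmod z < 1" for z
  proof -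
    have "z \<noteq> 1" using that by auto
    have "M z = (a + cnj a * z) * cnj (1 - z) / (cmod (1 - z))\<^sup>2"
      unfolding M_def by (rule complex_div_cnj)
    moreover have "Re ((a + cnj a * z) * cnj (1 - z)) = Re a * (1 - (cmod z)\<^sup>2)"
      unfolding cmod_power2 by (simp add: algebra_simps power2_eq_square)
    ultimately have "Re (M z) = Re a * (1 - (cmod z)\<^sup>2) / (cmod (1 - z))\<^sup>2"
      by (simp only: Re_divide_of_real)
    moreover have "(cmod z)\<^sup>2 < 1" using that by (simp add: power_less_one_iff)
    ultimately show ?thesis using Rea \<open>z \<noteq> 1\<close> by (simp add: half_plane_iff)
  qed
  have M_hol: "M holomorphic_on ball 0 1"
    unfolding M_def by (intro holomorphic_intros) auto
  have nz: "f (M z) + cnj (f a) \<noteq> 0" if "cmod z < 1" for z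
    using pos[OF M_pos[OF that]] pos[OF a] by (intro add_cnj_nonzero) auto
  have "f \<circ> M holomorphic_on ball 0 1"
    using M_hol f by (rule holomorphic_on_compose_gen) (use M_pos in auto)
  then have fM: "(\<lambda>z. f (M z)) holomorphic_on ball 0 1"
    by (simp add: o_def)
  have "\<psi> holomorphic_on ball 0 1"
    unfolding \<psi>_def using nz by (intro holomorphic_intros fM) auto
  moreover have "\<psi> 0 = 0" by (simp add: \<psi>_def M_def)
  moreover have "cmod (\<psi> z) < 1" if "cmod z < 1" for z
  proof -
    have "(cmod (f (M z) - f a))\<^sup>2 < (cmod (f (M z) + cnj (f a)))\<^sup>2"
      using pos[OF M_pos[OF that]] pos[OF a] by (simp add: cmod_add_cnj_power2)
    then have "cmod (f (M z) - f a) < cmod (f (M z) + cnj (f a))"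
      by (simp add: power2_less_imp_less)
    then show ?thesis using nz[OF that] by (simp add: \<psi>_def norm_divide)
  qed
  moreover define \<xi> where "\<xi> = (w - a) / (w + cnj a)"
  have wa: "w + cnj a \<noteq> 0" using Rea Rew by (intro add_cnj_nonzero) auto
  moreover have \<xi>: "cmod \<xi> < 1"
  proof -
    have "(cmod (w - a))\<^sup>2 < (cmod (w + cnj a))\<^sup>2"
      using Rea Rew by (simp add: cmod_add_cnj_power2)
    then have "cmod (w - a) < cmod (w + cnj a)"
      by (simp add: power2_less_imp_less)
    then show ?thesis using wa by (simp add: \<xi>_def norm_divide)
  qed
  ultimately have "cmod (\<psi> \<xi>) \<le> cmod \<xi>"
    using Schwarz_Lemma(1) by blast
  moreover have "M \<xi> = w"
  proof -
    have acnj: "a + cnj a \<noteq> 0" using Rea by (intro add_cnj_nonzero) auto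
    have "1 - \<xi> = (a + cnj a) / (w + cnj a)"
      using wa by (simp add: \<xi>_def field_simps)
    moreover have "a + cnj a * \<xi> = w * (a + cnj a) / (w + cnj a)"
      using wa by (simp add: \<xi>_def field_simps)
    ultimately show ?thesis using wa acnj by (simp add: M_def)
  qed
  ultimately have "cmod ((f w - f a) / (f w + cnj (f a))) \<le> cmod ((w - a) / (w + cnj a))"
    by (simp add: \<psi>_def \<xi>_def)
  moreover have "f w + cnj (f a) \<noteq> 0"
    using nz[OF \<xi>] \<open>M \<xi> = w\<close> by simp
  ultimately show ?thesis
    using wa by (simp add: norm_divide divide_simps mult.commute split: if_splits)
qed

text \<open>Both squared differences are rewritten by \<open>cmod_add_cnj_power2\<close>; the
  products of squared sums cancel, and only real parts and sums remain.\<close>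

lemma Schwarz_Pick_half_plane_Re:
  assumes f: "f holomorphic_on half_plane"
    and pos: "\<And>w. w \<in> half_plane \<Longrightarrow> 0 < Re (f w)"
    and w: "w \<in> half_plane" and a: "a \<in> half_plane"
  shows "Re w * Re a * (cmod (f w + cnj (f a)))\<^sup>2 \<le> Re (f w) * Re (f a) * (cmod (w + cnj a))\<^sup>2"
proof -
  have "(cmod (f w - f a) * cmod (w + cnj a))\<^sup>2 \<le> (cmod (f w + cnj (f a)) * cmod (w - a))\<^sup>2"
    using Schwarz_Pick_half_plane[OF assms] by (intro power_mono) auto
  moreover have "(cmod (f w - f a))\<^sup>2 = (cmod (f w + cnj (f a)))\<^sup>2 - 4 * Re (f w) * Re (f a)"
    "(cmod (w - a))\<^sup>2 = (cmod (w + cnj a))\<^sup>2 - 4 * Re w * Re a"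
    by (simp_all add: cmod_add_cnj_power2)
  ultimately show ?thesis
    by (simp add: power_mult_distrib algebra_simps)
qed

text \<open>Adding a constant \<open>d > 0\<close> makes the real part positive, and the inequality
  is closed under \<open>d\<close> tending to 0.\<close>

lemma Schwarz_Pick_half_plane_Re_nonneg:
  assumes f: "f holomorphic_on half_plane"
    and nonneg: "\<And>w. w \<in> half_plane \<Longrightarrow> 0 \<le> Re (f w)"
    and w: "w \<in> half_plane" and a: "a \<in> half_plane"
  shows "Re w * Re a * (cmod (f w + cnj (f a)))\<^sup>2 \<le> Re (f w) * Re (f a) * (cmod (w + cnj a))\<^sup>2"
proof -
  define F where "F = (\<lambda>d::real. \<lambda>w. f w + of_real d)"
  have "Re w * Re a * (cmod (F d w + cnj (F d a)))\<^sup>2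
      \<le> Re (F d w) * Re (F d a) * (cmod (w + cnj a))\<^sup>2" if "d > 0" for d
    using w a unfolding F_def
    by (intro Schwarz_Pick_half_plane_Re holomorphic_intros f)
      (use nonneg that in \<open>auto simp: add_nonneg_pos\<close>)
  then have ev: "\<forall>\<^sub>F d in at_right 0. Re w * Re a * (cmod (F d w + cnj (F d a)))\<^sup>2
      \<le> Re (F d w) * Re (F d a) * (cmod (w + cnj a))\<^sup>2"
    by (intro eventually_mono[OF eventually_at_right_less])
  have lim: "((\<lambda>d. F d x) \<longlongrightarrow> f x) (at_right 0)" for x
  proof -
    have "((\<lambda>d::real. f x + of_real d) \<longlongrightarrow> f x + of_real 0) (at_right 0)"
      by (intro tendsto_intros)
    then show ?thesis by (simp add: F_def)
  qed
  show ?thesis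
    by (rule tendsto_le[OF _ _ _ ev]) (auto intro!: tendsto_intros lim)
qed

text \<open>The infinitesimal form: divide the Schwarz--Pick inequality by |w - a| and let
  \<open>w\<close> tend to \<open>a\<close>.\<close>

lemma Schwarz_Pick_half_plane_deriv:
  assumes f: "f holomorphic_on half_plane"
    and pos: "\<And>w. w \<in> half_plane \<Longrightarrow> 0 < Re (f w)"
    and a: "a \<in> half_plane"
  shows "cmod (deriv f a) * Re a \<le> Re (f a)"
proof -
  have Df: "(f has_field_derivative deriv f a) (at a)"
    using f open_half_plane a by (rule holomorphic_derivI)
  then have lim1: "((\<lambda>w. cmod ((f w - f a) / (w - a)) * cmod (w + cnj a))
      \<longlongrightarrow> cmod (deriv f a) * cmod (a + cnj a)) (at a)"
    unfolding has_field_derivative_iff by (intro tendsto_intros)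
  have "(f \<longlongrightarrow> f a) (at a)"
    using DERIV_isCont[OF Df] by (simp add: isCont_def)
  then have lim2: "((\<lambda>w. cmod (f w + cnj (f a))) \<longlongrightarrow> cmod (f a + cnj (f a))) (at a)"
    by (intro tendsto_intros)
  have "\<forall>\<^sub>F w in at a. w \<in> half_plane \<and> w \<noteq> a"
    using a open_half_plane by (simp add: eventually_at_in_open' eventually_conj eventually_neq_at_within)
  then have "\<forall>\<^sub>F w in at a. cmod ((f w - f a) / (w - a)) * cmod (w + cnj a)
      \<le> cmod (f w + cnj (f a))"
  proof eventually_elim
    case (elim w)
    then show ?case
      using Schwarz_Pick_half_plane[OF f pos _ a, of w]
      by (simp add: norm_divide divide_simps mult.commute)
  qed
  then have "cmod (deriv f a) * cmod (a + cnj a) \<le> cmod (f a + cnj (f a))"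
    by (intro tendsto_le[OF _ lim2 lim1]) auto
  moreover have "cmod (a + cnj a) = 2 * Re a" "cmod (f a + cnj (f a)) = 2 * Re (f a)"
    using a pos[OF a] by (auto simp: complex_add_cnj half_plane_iff norm_mult)
  ultimately show ?thesis by simp
qed

section \<open>Boundary versions of the Schwarz--Pick lemma at infinity\<close>

text \<open>Seen from far away, all base points \<open>a\<close> look alike. This removes the base
  point from Schwarz--Pick inequalities along an escaping orbit.\<close>

lemma tendsto_norm_add_cnj_ratio:
  "((\<lambda>z. cmod (a + cnj z) / cmod (1 + z)) \<longlongrightarrow> 1) at_infinity"
proof -
  have "filterlim (\<lambda>z. 1 + cnj z) at_infinity at_infinity"
    by (intro tendsto_add_filterlim_at_infinity[where c = 1] tendsto_const)
      (simp add: filterlim_at_infinity_conv_norm_at_top filterlim_norm_at_top)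
  then have "((\<lambda>z. (a - 1) / (1 + cnj z)) \<longlongrightarrow> 0) at_infinity"
    by (rule tendsto_divide_0[OF tendsto_const])
  then have "((\<lambda>z. cmod (1 + (a - 1) / (1 + cnj z))) \<longlongrightarrow> cmod (1 + 0)) at_infinity"
    by (intro tendsto_intros)
  moreover have "\<forall>\<^sub>F z in at_infinity.
      cmod (1 + (a - 1) / (1 + cnj z)) = cmod (a + cnj z) / cmod (1 + z)"
    using eventually_not_equal_at_infinity[of "-1"]
  proof eventually_elim
    case (elim z)
    then have nz: "1 + cnj z \<noteq> 0"
      by (metis add_eq_0_iff complex_cnj_minus complex_cnj_one complex_cnj_cnj)
    then have "1 + (a - 1) / (1 + cnj z) = (a + cnj z) / (1 + cnj z)"
      by (simp add: field_simps)
    moreover have "cmod (1 + cnj z) = cmod (1 + z)"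
      by (metis complex_cnj_add complex_cnj_one complex_mod_cnj)
    ultimately show ?case by (simp add: norm_divide)
  qed
  ultimately show ?thesis
    by (auto elim: Lim_transform_eventually)
qed

text \<open>
  The quantity \<open>Re z / |1 + z|\<^sup>2\<close> tends to 0
  along the orbit, so it fails to increase infinitely often; at these times the Schwarz--Pick
  inequality between \<open>w\<close> and the orbit passes to the limit.
\<close>

lemma Re_le_Re_if_orbit_escapes:
  assumes F: "F holomorphic_on half_plane"
    and Fpos: "\<And>w. w \<in> half_plane \<Longrightarrow> 0 < Re (F w)"
    and orbit: "\<And>n. \<zeta> n \<in> half_plane" "\<And>n. \<zeta> (Suc n) = F (\<zeta> n)"
    and escape: "filterlim \<zeta> at_infinity sequentially"
    and w: "w \<in> half_plane"
  shows "Re w \<le> Re (F w)"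
proof (rule ccontr)
  assume "\<not> Re w \<le> Re (F w)"
  then have less: "Re (F w) < Re w" by simp
  \<comment> \<open>Up to the factor 4 this is 1 - |u|^2, where u = (z - 1) / (z + 1) is the disk
    point corresponding to the orbit point z; so it decays when the orbit escapes.\<close>
  define \<kappa> where "\<kappa> = (\<lambda>n. Re (\<zeta> n) / (cmod (1 + \<zeta> n))\<^sup>2)"
  define A where "A = (\<lambda>n. (cmod (w + cnj (\<zeta> n)) / cmod (1 + \<zeta> n))\<^sup>2)"
  define B where "B = (\<lambda>n. (cmod (F w + cnj (\<zeta> (Suc n))) / cmod (1 + \<zeta> (Suc n)))\<^sup>2)"
  have Re_pos: "0 < Re (\<zeta> n)" for n
    using orbit(1)[of n] by (simp add: half_plane_iff)
  have cm: "0 < cmod (1 + \<zeta> n)" for n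
  proof -
    have "Re (1 + \<zeta> n) > 0" using Re_pos[of n] by simp
    then show ?thesis by (metis less_irrefl zero_complex.simps(1) zero_less_norm_iff)
  qed
  have \<kappa>_pos: "0 < \<kappa> n" for n
    using cm[of n] Re_pos[of n] by (simp add: \<kappa>_def)
  have escape': "filterlim (\<lambda>n. \<zeta> (Suc n)) at_infinity sequentially"
    using escape by (rule filterlim_compose) (rule filterlim_Suc)
  have "(\<lambda>n. (cmod (w + cnj (\<zeta> n)) / cmod (1 + \<zeta> n))\<^sup>2) \<longlonglongrightarrow> 1\<^sup>2"
    by (intro tendsto_power filterlim_compose[OF tendsto_norm_add_cnj_ratio escape])
  from tendsto_mult_left[OF this, of "Re (F w)"]
  have limA: "(\<lambda>n. Re (F w) * A n) \<longlonglongrightarrow> Re (F w)"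
    by (simp add: A_def)
  have "(\<lambda>n. (cmod (F w + cnj (\<zeta> (Suc n))) / cmod (1 + \<zeta> (Suc n)))\<^sup>2) \<longlonglongrightarrow> 1\<^sup>2"
    by (intro tendsto_power filterlim_compose[OF tendsto_norm_add_cnj_ratio escape'])
  from tendsto_mult_left[OF this, of "Re w"]
  have limB: "(\<lambda>n. Re w * B n) \<longlonglongrightarrow> Re w"
    by (simp add: B_def)
  \<comment> \<open>Since \<open>A n\<close> and \<open>B n\<close> tend to 1, the strict inequality
    assumed for contradiction survives these factors for large \<open>n\<close>.\<close>
  have "\<forall>\<^sub>F n in sequentially. Re (F w) * A n < Re w * B n"
  proof -
    obtain m where m: "Re (F w) < m" "m < Re w" using less dense by blast
    show ?thesis
      using order_tendstoD(2)[OF limA m(1)] order_tendstoD(1)[OF limB m(2)]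
      by eventually_elim simp
  qed
  then obtain N where N: "\<And>n. n \<ge> N \<Longrightarrow> Re (F w) * A n < Re w * B n"
    by (auto simp: eventually_sequentially)
  have step: "\<kappa> n < \<kappa> (Suc n)" if "n \<ge> N" for n
  proof (rule ccontr)
    assume "\<not> \<kappa> n < \<kappa> (Suc n)"
    then have le: "\<kappa> (Suc n) \<le> \<kappa> n" by simp
    have "Re w * Re (\<zeta> n) * (cmod (F w + cnj (\<zeta> (Suc n))))\<^sup>2
        \<le> Re (F w) * Re (\<zeta> (Suc n)) * (cmod (w + cnj (\<zeta> n)))\<^sup>2"
      unfolding orbit(2) by (rule Schwarz_Pick_half_plane_Re[OF F Fpos w orbit(1)])
    then have "Re w * Re (\<zeta> n) * (cmod (F w + cnj (\<zeta> (Suc n))))\<^sup>2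
         / ((cmod (1 + \<zeta> n))\<^sup>2 * (cmod (1 + \<zeta> (Suc n)))\<^sup>2)
       \<le> Re (F w) * Re (\<zeta> (Suc n)) * (cmod (w + cnj (\<zeta> n)))\<^sup>2
         / ((cmod (1 + \<zeta> n))\<^sup>2 * (cmod (1 + \<zeta> (Suc n)))\<^sup>2)"
      by (rule divide_right_mono) simp
    then have "\<kappa> n * (Re w * B n) \<le> \<kappa> (Suc n) * (Re (F w) * A n)"
      by (simp add: \<kappa>_def A_def B_def power_divide mult_ac)
    also have "\<dots> \<le> \<kappa> n * (Re (F w) * A n)"
      using Fpos[OF w] by (intro mult_right_mono le) (auto simp: A_def)
    finally have "Re w * B n \<le> Re (F w) * A n"
      using \<kappa>_pos[of n] by simp
    with N[OF that] show False by simp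
  qed
  have "\<kappa> N \<le> \<kappa> n" if "n \<ge> N" for n
    using that by (induction n rule: dec_induct) (use step in \<open>auto intro: less_imp_le order_trans\<close>)
  then have ev: "\<forall>\<^sub>F n in sequentially. \<kappa> N \<le> \<kappa> n"
    by (auto simp: eventually_sequentially)
  have lim\<kappa>: "\<kappa> \<longlonglongrightarrow> 0"
  proof (rule tendsto_sandwich[OF always_eventually always_eventually tendsto_const])
    have "filterlim (\<lambda>n. 1 + \<zeta> n) at_infinity sequentially"
      by (intro tendsto_add_filterlim_at_infinity[OF tendsto_const escape])
    then have "filterlim (\<lambda>n. cmod (1 + \<zeta> n)) at_top sequentially"
      by (simp add: filterlim_at_infinity_conv_norm_at_top)
    then show "(\<lambda>n. inverse (cmod (1 + \<zeta> n))) \<longlonglongrightarrow> 0"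
      by (rule tendsto_inverse_0_at_top)
    show "\<forall>n. 0 \<le> \<kappa> n" using \<kappa>_pos by (auto intro: less_imp_le)
    show "\<forall>n. \<kappa> n \<le> inverse (cmod (1 + \<zeta> n))"
    proof
      fix n
      have "Re (\<zeta> n) \<le> cmod (1 + \<zeta> n)"
        using complex_Re_le_cmod[of "1 + \<zeta> n"] by simp
      then show "\<kappa> n \<le> inverse (cmod (1 + \<zeta> n))"
        using cm[of n] by (simp add: \<kappa>_def field_simps power2_eq_square)
    qed
  qed
  have "\<kappa> N \<le> 0"
    by (rule tendsto_lowerbound[OF lim\<kappa> ev]) simp
  with \<kappa>_pos[of N] show False by simp
qed

section \<open>The Julia--Wolff--Caratheodory theorem at infinity\<close>

definition sector :: "real \<Rightarrow> complex set"
  where "sector M = {w. 0 < Re w \<and> cmod w \<le> M * Re w}"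

text \<open>The infimum form makes the lower bound for \<open>Re (P w)\<close> immediate; that it is
  also the angular limit of \<open>P w / w\<close> is the content of
  \<open>tendsto_angular_derivative\<close>.\<close>

definition angular_derivative :: "(complex \<Rightarrow> complex) \<Rightarrow> real"
  where "angular_derivative P = (INF w\<in>half_plane. Re (P w) / Re w)"

lemma angular_derivative_bounds:
  assumes "\<And>w. w \<in> half_plane \<Longrightarrow> 0 \<le> Re (P w)"
  shows "0 \<le> angular_derivative P"
    and "w \<in> half_plane \<Longrightarrow> angular_derivative P * Re w \<le> Re (P w)"
proof -
  have nonneg: "0 \<le> Re (P w) / Re w" if "w \<in> half_plane" for w
    using assms[OF that] that by (simp add: half_plane_iff)
  have "1 \<in> half_plane" by (simp add: half_plane_iff)
  then show "0 \<le> angular_derivative P"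
    unfolding angular_derivative_def by (intro cINF_greatest nonneg) auto
  assume w: "w \<in> half_plane"
  have "angular_derivative P \<le> Re (P w) / Re w"
    unfolding angular_derivative_def
    by (intro cINF_lower w bdd_belowI2[where m = 0] nonneg)
  then show "angular_derivative P * Re w \<le> Re (P w)"
    using w by (simp add: half_plane_iff field_simps)
qed

text \<open>After subtracting \<open>c * w\<close>, the real part is still nonnegative, and at some
  point \<open>w0\<close> it is tiny relative to \<open>Re w0\<close>. Schwarz--Pick against this
  one point makes the remainder small relative to |w| everywhere far out in the sector.\<close>

lemma tendsto_angular_derivative:
  assumes P: "P holomorphic_on half_plane"
    and nonneg: "\<And>w. w \<in> half_plane \<Longrightarrow> 0 \<le> Re (P w)"
  shows "((\<lambda>w. P w / w) \<longlongrightarrow> of_real (angular_derivative P))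
    (inf at_infinity (principal (sector M)))"
proof (cases "M > 0")
  case False
  have "M * x \<le> 0" if "x > 0" for x
    using False that by (simp add: mult_nonpos_nonneg)
  moreover have "\<not> cmod w \<le> 0" if "Re w > 0" for w
    using that by auto
  ultimately have "sector M = {}"
    unfolding sector_def by (metis (no_types, lifting) Collect_empty_eq order_trans)
  then show ?thesis by simp
next
  case M: True
  define c where "c = angular_derivative P"
  define Q where "Q = (\<lambda>w. P w - of_real c * w)"
  have Q: "Q holomorphic_on half_plane"
    unfolding Q_def by (intro holomorphic_intros P)
  have Qnn: "0 \<le> Re (Q w)" if "w \<in> half_plane" for w
    using angular_derivative_bounds(2)[OF nonneg that] by (simp add: Q_def c_def)
  show ?thesis unfolding c_def[symmetric]
  proof (rule tendstoI)
    fix e :: real assume e: "e > 0"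
    \<comment> \<open>Chosen so that \<open>4 * M * \<epsilon> = e / 2\<close>. With the share
      \<open>e / 4\<close> for \<open>Q w0\<close>, secured by \<open>R\<close> below, the total is
      \<open>3 * e / 4 < e\<close>.\<close>
    define \<epsilon> where "\<epsilon> = e / (8 * M)"
    have \<epsilon>: "\<epsilon> > 0" using e M by (simp add: \<epsilon>_def)
    have "\<exists>y\<in>(\<lambda>w. Re (P w) / Re w) ` half_plane. y < c + \<epsilon>"
    proof (rule cInf_lessD)
      show "(\<lambda>w. Re (P w) / Re w) ` half_plane \<noteq> {}"
        using half_plane_iff[of 1] by auto
      show "Inf ((\<lambda>w. Re (P w) / Re w) ` half_plane) < c + \<epsilon>"
        using \<epsilon> by (simp add: c_def angular_derivative_def)
    qed
    then obtain w0 where w0: "w0 \<in> half_plane" and "Re (P w0) / Re w0 < c + \<epsilon>" by auto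
    then have Q0: "Re (Q w0) \<le> \<epsilon> * Re w0"
      by (simp add: Q_def half_plane_iff field_simps)
    define R where "R = max 1 (max (cmod w0) (4 * cmod (Q w0) / e))"
    have "dist (P w / w) c < e" if wR: "R \<le> cmod w" and ws: "w \<in> sector M" for w
    proof -
      have w: "w \<in> half_plane" and wM: "cmod w \<le> M * Re w" and Rew: "Re w > 0"
        using ws by (auto simp: sector_def half_plane_iff)
      have w_nz: "w \<noteq> 0" using Rew by auto
      have w1: "1 \<le> cmod w" and w0w: "cmod w0 \<le> cmod w" and "4 * cmod (Q w0) / e \<le> cmod w"
        using wR by (auto simp: R_def)
      then have Q0w: "cmod (Q w0) \<le> e / 4 * cmod w"
        using e by (simp add: field_simps)
      define X where "X = cmod (Q w + cnj (Q w0))"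
      have X0: "X \<ge> 0" by (simp add: X_def)
      have "cmod (w + cnj w0) \<le> cmod w + cmod w0"
        by (metis complex_mod_cnj norm_triangle_ineq)
      then have wsum: "(cmod (w + cnj w0))\<^sup>2 \<le> (2 * cmod w)\<^sup>2"
        using w0w by (intro power_mono) auto
      have ReX: "Re (Q w) \<le> X"
        using complex_Re_le_cmod[of "Q w + cnj (Q w0)"] Qnn[OF w0] by (simp add: X_def)
      \<comment> \<open>Bounding \<open>Re (Q w)\<close> by \<open>X\<close> leaves the right side
        linear in \<open>X\<close> while the left is quadratic, so cancelling one \<open>X\<close>
        yields a bound for \<open>X\<close> itself.\<close>
      have "Re w0 * (Re w * X\<^sup>2) \<le> Re (Q w) * Re (Q w0) * (cmod (w + cnj w0))\<^sup>2"
        using Schwarz_Pick_half_plane_Re_nonneg[OF Q Qnn w w0] by (simp add: X_def mult_ac)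
      also have "\<dots> \<le> X * (\<epsilon> * Re w0) * (2 * cmod w)\<^sup>2"
        using Qnn[OF w] Qnn[OF w0] w0 \<epsilon> X0
        by (intro mult_mono ReX Q0 wsum) (auto simp: half_plane_iff)
      finally have "Re w0 * (Re w * X\<^sup>2) \<le> Re w0 * (X * \<epsilon> * (2 * cmod w)\<^sup>2)"
        by (simp add: mult_ac)
      then have "Re w * X\<^sup>2 \<le> X * \<epsilon> * (2 * cmod w)\<^sup>2"
        using w0 by (simp add: half_plane_iff)
      then have "X * (Re w * X) \<le> X * (4 * \<epsilon> * (cmod w)\<^sup>2)"
        by (simp add: power2_eq_square mult_ac)
      then have *: "X = 0 \<or> Re w * X \<le> 4 * \<epsilon> * (cmod w)\<^sup>2"
        using X0 by (auto simp: mult_le_cancel_left)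
      have "X \<le> e / 2 * cmod w"
        using *
      proof
        assume "Re w * X \<le> 4 * \<epsilon> * (cmod w)\<^sup>2"
        have "cmod w * X \<le> M * (Re w * X)"
          using mult_right_mono[OF wM X0] by (simp add: mult_ac)
        also have "\<dots> \<le> M * (4 * \<epsilon> * (cmod w)\<^sup>2)"
          using M \<open>Re w * X \<le> _\<close> by (intro mult_left_mono) auto
        also have "\<dots> = cmod w * (e / 2 * cmod w)"
          using M by (simp add: \<epsilon>_def power2_eq_square)
        finally show ?thesis
          by (rule mult_left_le_imp_le) (use w1 in linarith)
      qed (use e in simp)
      moreover have "cmod (Q w) \<le> X + cmod (Q w0)"
        using norm_triangle_ineq4[of "Q w + cnj (Q w0)" "cnj (Q w0)"] by (simp add: X_def)
      ultimately have "cmod (Q w) \<le> 3 * e / 4 * cmod w" using Q0w by simp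
      also have "\<dots> < e * cmod w" using e w_nz by simp
      finally have "cmod (Q w) < e * cmod w" .
      moreover have "P w / w - c = Q w / w" using w_nz by (simp add: Q_def field_simps)
      ultimately show ?thesis using w_nz by (simp add: dist_norm norm_divide field_simps)
    qed
    then show "\<forall>\<^sub>F w in inf at_infinity (principal (sector M)). dist (P w / w) c < e"
      unfolding eventually_inf_principal eventually_at_infinity by blast
  qed
qed

section \<open>Solutions of Abel's equation on the half-plane\<close>

text \<open>In the coordinate \<open>g\<close> the semigroup is translation to the right; the
  assumption \<open>escape\<close> places its Denjoy--Wolff point at infinity.\<close>

locale abel_flow =
  fixes g :: "complex \<Rightarrow> complex"
  assumes hol: "g holomorphic_on half_plane"
    and inj: "inj_on g half_plane"
    and shift: "w \<in> half_plane \<Longrightarrow> 0 \<le> t \<Longrightarrow> g w + complex_of_real t \<in> g ` half_plane"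
    and escape: "w \<in> half_plane \<Longrightarrow>
      filterlim (\<lambda>t. inv_into half_plane g (g w + complex_of_real t)) at_infinity at_top"
begin

section \<open>The semigroup and its generator\<close>

definition flow :: "real \<Rightarrow> complex \<Rightarrow> complex"
  where "flow t w = inv_into half_plane g (g w + complex_of_real t)"

text \<open>Differentiating \<open>g (flow t w) = g w + t\<close> in \<open>t\<close> gives this
  infinitesimal generator.\<close>

definition vfield :: "complex \<Rightarrow> complex"
  where "vfield w = 1 / deriv g w"

lemma flow_in: "w \<in> half_plane \<Longrightarrow> 0 \<le> t \<Longrightarrow> flow t w \<in> half_plane"
  unfolding flow_def by (intro inv_into_into shift)

lemma g_flow: "w \<in> half_plane \<Longrightarrow> 0 \<le> t \<Longrightarrow> g (flow t w) = g w + complex_of_real t"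
  unfolding flow_def by (intro f_inv_into_f shift)

lemma flow_0: "w \<in> half_plane \<Longrightarrow> flow 0 w = w"
  using inj by (simp add: flow_def)

lemma flow_add:
  "w \<in> half_plane \<Longrightarrow> 0 \<le> t \<Longrightarrow> flow s (flow t w) = flow (s + t) w"
  by (simp add: flow_def[of s] g_flow) (simp add: flow_def add_ac)

lemma g_deriv: "w \<in> half_plane \<Longrightarrow> (g has_field_derivative deriv g w) (at w)"
  using hol open_half_plane by (rule holomorphic_derivI)

lemma deriv_g_nonzero: "w \<in> half_plane \<Longrightarrow> deriv g w \<noteq> 0"
  using hol open_half_plane inj by (rule holomorphic_injective_imp_regular)

lemma vfield_holomorphic: "vfield holomorphic_on half_plane"
  unfolding vfield_def
  by (intro holomorphic_intros holomorphic_deriv hol open_half_plane deriv_g_nonzero)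

lemma open_range: "open (g ` half_plane)"
  using hol open_half_plane inj by (rule open_mapping_thm3)

lemma inv_deriv:
  assumes w: "w \<in> half_plane"
  shows "(inv_into half_plane g has_field_derivative vfield w) (at (g w))"
proof -
  obtain G where G: "G holomorphic_on g ` half_plane"
    "\<And>z. z \<in> half_plane \<Longrightarrow> deriv g z * deriv G (g z) = 1"
    "\<And>z. z \<in> half_plane \<Longrightarrow> G (g z) = z"
    using holomorphic_has_inverse[OF hol open_half_plane inj] by metis
  have "(G has_field_derivative deriv G (g w)) (at (g w))"
    using G(1) open_range w by (intro holomorphic_derivI) auto
  moreover have "deriv G (g w) = vfield w"
    using G(2)[OF w] deriv_g_nonzero[OF w] by (simp add: vfield_def field_simps)
  ultimately have "(G has_field_derivative vfield w) (at (g w))" by simp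
  then show ?thesis
  proof (rule has_field_derivative_transform_within_open)
    show "open (g ` half_plane)" by (rule open_range)
    show "g w \<in> g ` half_plane" using w by simp
    show "G y = inv_into half_plane g y" if "y \<in> g ` half_plane" for y
      using that G(3) inj by auto
  qed
qed

lemma flow_deriv:
  assumes w: "w \<in> half_plane" and t: "0 \<le> t"
  shows "((\<lambda>s. flow s w) has_vector_derivative vfield (flow t w)) (at t)"
proof -
  have "((\<lambda>s. g w + complex_of_real s) has_vector_derivative 1) (at t)"
    by (auto intro!: derivative_eq_intros)
  moreover have "(inv_into half_plane g has_field_derivative vfield (flow t w))
      (at (g w + complex_of_real t))"
    using inv_deriv[OF flow_in[OF assms]] by (simp add: g_flow[OF assms])
  ultimately have "((inv_into half_plane g \<circ> (\<lambda>s. g w + complex_of_real s))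
      has_vector_derivative 1 * vfield (flow t w)) (at t)"
    by (rule field_vector_diff_chain_at)
  then show ?thesis by (simp add: o_def flow_def[abs_def])
qed

lemma flow_deriv_Re:
  assumes "w \<in> half_plane" "0 \<le> t"
  shows "((\<lambda>s. Re (flow s w)) has_real_derivative Re (vfield (flow t w))) (at t)"
  using bounded_linear.has_vector_derivative[OF bounded_linear_Re flow_deriv[OF assms]]
  by (simp add: has_real_derivative_iff_has_vector_derivative)

lemma flow_deriv_Im:
  assumes "w \<in> half_plane" "0 \<le> t"
  shows "((\<lambda>s. Im (flow s w)) has_real_derivative Im (vfield (flow t w))) (at t)"
  using bounded_linear.has_vector_derivative[OF bounded_linear_Im flow_deriv[OF assms]]
  by (simp add: has_real_derivative_iff_has_vector_derivative)

lemma flow_has_field_derivative: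
  assumes w: "w \<in> half_plane" and t: "0 \<le> t"
  shows "(flow t has_field_derivative deriv g w * vfield (flow t w)) (at w)"
proof -
  have "((\<lambda>w. g w + complex_of_real t) has_field_derivative deriv g w) (at w)"
    using g_deriv[OF w] by (auto intro!: derivative_eq_intros)
  moreover have "(inv_into half_plane g has_field_derivative vfield (flow t w))
      (at (g w + complex_of_real t))"
    using inv_deriv[OF flow_in[OF assms]] by (simp add: g_flow[OF assms])
  ultimately have "((\<lambda>w. inv_into half_plane g (g w + complex_of_real t))
      has_field_derivative vfield (flow t w) * deriv g w) (at w)"
    by (rule DERIV_chain2[rotated])
  then show ?thesis by (simp add: flow_def[abs_def] mult.commute)
qed

lemma flow_holomorphic: "0 \<le> t \<Longrightarrow> flow t holomorphic_on half_plane"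
  using flow_has_field_derivative open_half_plane
  by (auto simp: holomorphic_on_open)

text \<open>The iterates of \<open>flow t\<close> sample the trajectory at the multiples of
  \<open>t\<close>, so they escape to infinity, and Wolff's lemma in the form
  \<open>Re_le_Re_if_orbit_escapes\<close> applies.\<close>

lemma Re_le_Re_flow:
  assumes w: "w \<in> half_plane" and t: "0 \<le> t"
  shows "Re w \<le> Re (flow t w)"
proof (cases "t = 0")
  case True
  then show ?thesis using flow_0[OF w] by simp
next
  case False
  with t have "t > 0" by simp
  show ?thesis
  proof (rule Re_le_Re_if_orbit_escapes)
    show "flow t holomorphic_on half_plane" by (rule flow_holomorphic[OF t])
    show "0 < Re (flow t z)" if "z \<in> half_plane" for z
      using flow_in[OF that t] by (simp add: half_plane_iff)
    show "flow (of_nat n * t) w \<in> half_plane" for n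
      using w t by (intro flow_in) auto
    show "flow (of_nat (Suc n) * t) w = flow t (flow (of_nat n * t) w)" for n
      using w t by (simp add: flow_add algebra_simps)
    have "filterlim (\<lambda>n. of_nat n * t) at_top sequentially"
      using \<open>t > 0\<close>
      by (intro filterlim_at_top_mult_tendsto_pos[OF tendsto_const _ filterlim_real_sequentially])
    then show "filterlim (\<lambda>n. flow (of_nat n * t) w) at_infinity sequentially"
      unfolding flow_def by (rule filterlim_compose[OF escape[OF w]])
  qed (rule w)
qed

text \<open>A generator pointing to the left at \<open>w\<close> would make the real part decrease
  for small times, against \<open>Re_le_Re_flow\<close>.\<close>

lemma Re_vfield_nonneg:
  assumes w: "w \<in> half_plane"
  shows "0 \<le> Re (vfield w)"
proof (rule ccontr)
  assume "\<not> 0 \<le> Re (vfield w)"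
  then have "Re (vfield (flow 0 w)) < 0" by (simp add: flow_0[OF w])
  then obtain d where "d > 0" "\<And>s. 0 < s \<Longrightarrow> s < d \<Longrightarrow> Re (flow (0 + s) w) < Re (flow 0 w)"
    using DERIV_neg_dec_right[OF flow_deriv_Re[OF w order_refl]] by blast
  from this(2)[of "d / 2"] this(1) have "Re (flow (d / 2) w) < Re w"
    by (simp add: flow_0[OF w])
  with Re_le_Re_flow[OF w, of "d / 2"] \<open>d > 0\<close> show False by simp
qed

text \<open>The angular derivative of the generator at the Denjoy--Wolff point. Each of the three
  equivalent assertions will be shown to mean that it is positive.\<close>

definition speed :: real
  where "speed = angular_derivative vfield"

lemma speed_nonneg: "0 \<le> speed"
  unfolding speed_def by (intro angular_derivative_bounds Re_vfield_nonneg)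

lemma speed_le: "w \<in> half_plane \<Longrightarrow> speed * Re w \<le> Re (vfield w)"
  unfolding speed_def by (intro angular_derivative_bounds Re_vfield_nonneg)

lemma tendsto_speed:
  "((\<lambda>w. vfield w / w) \<longlongrightarrow> of_real speed) (inf at_infinity (principal (sector M)))"
  unfolding speed_def
  by (intro tendsto_angular_derivative vfield_holomorphic Re_vfield_nonneg)

lemma tendsto_id_mult_deriv:
  assumes "0 < speed"
  shows "((\<lambda>w. w * deriv g w) \<longlongrightarrow> of_real (1 / speed)) (inf at_infinity (principal (sector M)))"
proof -
  have "((\<lambda>w. inverse (vfield w / w)) \<longlongrightarrow> inverse (of_real speed))
      (inf at_infinity (principal (sector M)))"
    using assms by (intro tendsto_inverse tendsto_speed) simp
  then show ?thesis by (simp add: vfield_def inverse_eq_divide mult.commute)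
qed

lemma norm_deriv_le:
  assumes "w \<in> half_plane"
  shows "speed * (Re w * cmod (deriv g w)) \<le> 1"
proof -
  have "speed * Re w \<le> cmod (vfield w)"
    using speed_le[OF assms] complex_Re_le_cmod by (rule order_trans)
  then show ?thesis
    using deriv_g_nonzero[OF assms] by (simp add: vfield_def norm_divide field_simps)
qed

text \<open>The chain rule gives \<open>flow t\<close> the derivative
  \<open>vfield (flow t w) / vfield w\<close> at \<open>w\<close>; the infinitesimal Schwarz--Pick
  lemma for the self-map \<open>flow t\<close> bounds it.\<close>

lemma norm_vfield_flow_le:
  assumes w: "w \<in> half_plane" and t: "0 \<le> t"
  shows "cmod (vfield (flow t w)) \<le> cmod (vfield w) / Re w * Re (flow t w)"
proof -
  have "cmod (deriv (flow t) w) * Re w \<le> Re (flow t w)"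
    using flow_in[OF _ t]
    by (intro Schwarz_Pick_half_plane_deriv flow_holomorphic w t) (simp add: half_plane_iff)
  moreover have "deriv (flow t) w = deriv g w * vfield (flow t w)"
    by (rule DERIV_imp_deriv[OF flow_has_field_derivative[OF w t]])
  ultimately have "cmod (deriv g w) * cmod (vfield (flow t w)) * Re w \<le> Re (flow t w)"
    by (simp add: norm_mult)
  then show ?thesis
    using w deriv_g_nonzero[OF w]
    by (simp add: vfield_def[of w] norm_divide half_plane_iff field_simps)
qed

text \<open>The real part grows at rate at least \<open>speed * Re (flow t w)\<close>, hence at
  least \<open>speed * Re w\<close>. Linear growth is enough to let a trajectory cross every large
  circle.\<close>

lemma Re_flow_ge:
  assumes w: "w \<in> half_plane" and t: "0 \<le> t"
  shows "Re w + speed * Re w * t \<le> Re (flow t w)"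
proof -
  have "Re (flow 0 w) - speed * Re w * 0 \<le> Re (flow t w) - speed * Re w * t"
  proof (rule DERIV_nonneg_imp_nondecreasing[OF t])
    fix s assume s: "0 \<le> s" "s \<le> t"
    have "((\<lambda>s. Re (flow s w) - speed * Re w * s) has_real_derivative
        Re (vfield (flow s w)) - speed * Re w) (at s)"
      by (rule derivative_eq_intros flow_deriv_Re[OF w s(1)] refl | simp)+
    moreover have "speed * Re w \<le> speed * Re (flow s w)"
      by (intro mult_left_mono Re_le_Re_flow w s speed_nonneg)
    then have "0 \<le> Re (vfield (flow s w)) - speed * Re w"
      using speed_le[OF flow_in[OF w s(1)]] by simp
    ultimately show "\<exists>y. ((\<lambda>s. Re (flow s w) - speed * Re w * s) has_real_derivative y) (at s)
        \<and> 0 \<le> y" by blast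
  qed
  then show ?thesis by (simp add: flow_0[OF w])
qed

text \<open>
  Along a trajectory \<open>|vfield| / Re\<close> does not increase while \<open>Re vfield \<ge> speed * Re\<close>, so the slope
  of the trajectory stays bounded.
\<close>

lemma flow_in_sector:
  assumes c: "0 < speed" and w: "w \<in> half_plane"
  obtains M where "\<And>t. 0 \<le> t \<Longrightarrow> flow t w \<in> sector M"
proof -
  define L where "L = cmod (vfield w) / Re w / speed"
  have L: "0 \<le> L" using c w by (simp add: L_def half_plane_iff)
  have slope: "\<bar>Im (vfield (flow s w))\<bar> \<le> L * Re (vfield (flow s w))" if s: "0 \<le> s" for s
  proof -
    have "\<bar>Im (vfield (flow s w))\<bar> \<le> cmod (vfield (flow s w))" by (rule abs_Im_le_cmod)
    also have "\<dots> \<le> L * (speed * Re (flow s w))"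
      using norm_vfield_flow_le[OF w s] c by (simp add: L_def)
    also have "\<dots> \<le> L * Re (vfield (flow s w))"
      by (intro mult_left_mono L speed_le flow_in w s)
    finally show ?thesis .
  qed
  \<comment> \<open>The sign \<open>\<sigma>\<close> treats upward and downward drift by one
    monotonicity argument.\<close>
  have bound: "\<sigma> * Im (flow t w) - \<sigma> * Im w \<le> L * (Re (flow t w) - Re w)"
    if \<sigma>: "\<bar>\<sigma>\<bar> = 1" and t: "0 \<le> t" for \<sigma> t
  proof -
    have "L * Re (flow 0 w) - \<sigma> * Im (flow 0 w) \<le> L * Re (flow t w) - \<sigma> * Im (flow t w)"
    proof (rule DERIV_nonneg_imp_nondecreasing[OF t])
      fix s assume s: "0 \<le> s" "s \<le> t"
      have "((\<lambda>s. L * Re (flow s w) - \<sigma> * Im (flow s w)) has_real_derivative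
          L * Re (vfield (flow s w)) - \<sigma> * Im (vfield (flow s w))) (at s)"
        by (rule derivative_eq_intros flow_deriv_Re[OF w s(1)] flow_deriv_Im[OF w s(1)] refl | simp)+
      moreover have "\<sigma> * Im (vfield (flow s w)) \<le> \<bar>Im (vfield (flow s w))\<bar>"
        using abs_ge_self[of "\<sigma> * Im (vfield (flow s w))"] \<sigma> by (simp add: abs_mult)
      then have "0 \<le> L * Re (vfield (flow s w)) - \<sigma> * Im (vfield (flow s w))"
        using slope[OF s(1)] by simp
      ultimately show "\<exists>y. ((\<lambda>s. L * Re (flow s w) - \<sigma> * Im (flow s w))
          has_real_derivative y) (at s) \<and> 0 \<le> y" by blast
    qed
    then show ?thesis by (simp add: flow_0[OF w] algebra_simps)
  qed
  have Rew: "Re w > 0" using w by (simp add: half_plane_iff)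
  \<comment> \<open>\<open>L\<close> bounds the slope, the last summand absorbs the starting point,
    and 1 comes from |z| <= |Re z| + |Im z|.\<close>
  have "flow t w \<in> sector (1 + L + \<bar>Im w\<bar> / Re w)" if t: "0 \<le> t" for t
  proof -
    have "\<bar>Im (flow t w)\<bar> \<le> \<bar>Im w\<bar> + L * (Re (flow t w) - Re w)"
      using bound[of 1, OF _ t] bound[of "-1", OF _ t] by simp
    also have "\<dots> \<le> \<bar>Im w\<bar> / Re w * Re (flow t w) + L * Re (flow t w)"
    proof (rule add_mono)
      have "\<bar>Im w\<bar> / Re w * Re w \<le> \<bar>Im w\<bar> / Re w * Re (flow t w)"
        using Rew by (intro mult_left_mono Re_le_Re_flow w t) auto
      then show "\<bar>Im w\<bar> \<le> \<bar>Im w\<bar> / Re w * Re (flow t w)" using Rew by simp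
      show "L * (Re (flow t w) - Re w) \<le> L * Re (flow t w)"
        using L Rew by (intro mult_left_mono) auto
    qed
    finally have "cmod (flow t w) \<le> (1 + L + \<bar>Im w\<bar> / Re w) * Re (flow t w)"
      using cmod_le[of "flow t w"] flow_in[OF w t]
      by (simp add: half_plane_iff algebra_simps)
    then show ?thesis using flow_in[OF w t] by (simp add: sector_def half_plane_iff)
  qed
  then show thesis by (rule that)
qed

end

text \<open>A Cauchy criterion in which the approximate value may depend on \<open>e\<close>. The
  values at the integers form a Cauchy sequence, and its limit is close to each approximate value,
  hence is the limit of \<open>f\<close>.\<close>

lemma tendsto_at_top_if_almost_constant:
  fixes f :: "real \<Rightarrow> real"
  assumes "\<And>e. e > 0 \<Longrightarrow> \<exists>y. \<forall>\<^sub>F x in at_top. \<bar>f x - y\<bar> \<le> e"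
  obtains a where "(f \<longlongrightarrow> a) at_top"
proof -
  have "Cauchy (\<lambda>n. f (real n))"
  proof (rule metric_CauchyI)
    fix e :: real assume "e > 0"
    then obtain y where y: "\<forall>\<^sub>F x in at_top. \<bar>f x - y\<bar> \<le> e / 3"
      using assms[of "e / 3"] by auto
    have "\<forall>\<^sub>F n in sequentially. \<bar>f (real n) - y\<bar> \<le> e / 3"
      by (rule eventually_compose_filterlim[OF y filterlim_real_sequentially])
    then obtain N where N: "\<And>n. n \<ge> N \<Longrightarrow> \<bar>f (real n) - y\<bar> \<le> e / 3"
      by (auto simp: eventually_sequentially)
    have "dist (f (real m)) (f (real n)) < e" if "m \<ge> N" "n \<ge> N" for m n
      using N[OF that(1)] N[OF that(2)] \<open>e > 0\<close> unfolding dist_real_def by linarith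
    then show "\<exists>N. \<forall>m\<ge>N. \<forall>n\<ge>N. dist (f (real m)) (f (real n)) < e" by blast
  qed
  then obtain a where a: "(\<lambda>n. f (real n)) \<longlonglongrightarrow> a"
    using Cauchy_convergent convergent_def by blast
  have "(f \<longlongrightarrow> a) at_top"
  proof (rule tendstoI)
    fix e :: real assume "e > 0"
    then obtain y where y: "\<forall>\<^sub>F x in at_top. \<bar>f x - y\<bar> \<le> e / 3"
      using assms[of "e / 3"] by auto
    have "\<forall>\<^sub>F n in sequentially. \<bar>f (real n) - y\<bar> \<le> e / 3"
      by (rule eventually_compose_filterlim[OF y filterlim_real_sequentially])
    then have "\<bar>a - y\<bar> \<le> e / 3"
      by (intro tendsto_upperbound[OF tendsto_rabs[OF tendsto_diff[OF a tendsto_const]]]) auto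
    from y show "\<forall>\<^sub>F x in at_top. dist (f x) a < e"
      unfolding dist_real_def
      by eventually_elim (use \<open>\<bar>a - y\<bar> \<le> e / 3\<close> \<open>e > 0\<close> in linarith)
  qed
  then show thesis by (rule that)
qed

section \<open>The imaginary part of \<open>g\<close> near infinity and the strip\<close>

context abel_flow
begin

text \<open>Along the circle w = R e^(i b), the derivative of \<open>Im (g w)\<close> in b is
  \<open>Re (w * deriv g w)\<close>, which for large \<open>R\<close> is uniformly close to
  \<open>1 / speed\<close> in the sector. The condition on \<open>cos \<alpha>\<close> says that the
  end point lies in \<open>sector M\<close>.\<close>

lemma Im_g_arc:
  assumes c: "0 < speed" and e: "0 < e"
  shows "\<exists>R0>0. \<forall>R\<ge>R0. \<forall>\<alpha>. \<bar>\<alpha>\<bar> < pi / 2 \<and> 1 \<le> M * cos \<alpha> \<longrightarrow>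
    \<bar>Im (g (of_real R * cis \<alpha>)) - Im (g (of_real R)) - \<alpha> / speed\<bar> \<le> e"
proof -
  \<comment> \<open>The arc has angle at most pi / 2, so a derivative error \<open>d\<close>
    accumulates to at most \<open>e\<close>.\<close>
  define d where "d = e / (pi / 2)"
  have d: "d > 0" using e by (simp add: d_def)
  have "\<forall>\<^sub>F w in inf at_infinity (principal (sector M)).
      dist (w * deriv g w) (of_real (1 / speed)) < d"
    using tendsto_id_mult_deriv[OF c] d by (rule tendstoD)
  then obtain b where b: "\<And>w. b \<le> cmod w \<Longrightarrow> w \<in> sector M \<Longrightarrow>
      cmod (w * deriv g w - of_real (1 / speed)) < d"
    by (auto simp: eventually_inf_principal eventually_at_infinity dist_norm)
  show ?thesis
  proof (intro exI[of _ "max 1 b"] conjI allI impI)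
    fix R \<alpha> :: real
    assume R: "max 1 b \<le> R" and \<alpha>: "\<bar>\<alpha>\<bar> < pi / 2 \<and> 1 \<le> M * cos \<alpha>"
    have R1: "R \<ge> 1" and Rb: "R \<ge> b" using R by auto
    have cos\<alpha>: "cos \<alpha> > 0" using \<alpha> by (intro cos_gt_zero_pi) auto
    have M: "M > 0"
    proof (rule ccontr)
      assume "\<not> M > 0"
      then have "M * cos \<alpha> \<le> 0" using cos\<alpha> by (simp add: mult_nonpos_nonneg)
      with \<alpha> show False by simp
    qed
    define F where "F = (\<lambda>\<beta>. Im (g (of_real R * cis \<beta>)) - \<beta> / speed)"
    define F' where "F' = (\<lambda>\<beta>. Re (of_real R * cis \<beta> * deriv g (of_real R * cis \<beta>)) - 1 / speed)"
    \<comment> \<open>A symmetric interval is one convex set containing 0 and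
      \<open>\<alpha>\<close> for either sign.\<close>
    define S where "S = {- \<bar>\<alpha>\<bar>..\<bar>\<alpha>\<bar>}"
    have sec: "of_real R * cis \<beta> \<in> sector M" if "\<beta> \<in> S" for \<beta>
    proof -
      have "cos \<bar>\<alpha>\<bar> \<le> cos \<bar>\<beta>\<bar>"
        using that \<alpha> by (intro cos_monotone_0_pi_le) (auto simp: S_def)
      then have le: "cos \<alpha> \<le> cos \<beta>" by simp
      then have "1 \<le> M * cos \<beta>"
        using \<alpha> mult_left_mono[OF le, of M] M by linarith
      then have "R * 1 \<le> R * (M * cos \<beta>)"
        using R1 by (intro mult_left_mono) auto
      then show ?thesis
        using R1 cos\<alpha> le by (simp add: sector_def norm_mult mult_ac)
    qed
    have "norm (F \<alpha> - F 0) \<le> d * norm (\<alpha> - 0)"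
    proof (rule field_differentiable_bound[where S = S and f' = F'])
      fix \<beta> assume \<beta>: "\<beta> \<in> S"
      let ?w = "of_real R * cis \<beta>"
      have w: "?w \<in> half_plane" using sec[OF \<beta>] by (simp add: sector_def half_plane_iff)
      have "((\<lambda>\<beta>. of_real R * cis \<beta>) has_vector_derivative of_real R * (\<i> * cis \<beta>)) (at \<beta>)"
        unfolding has_vector_derivative_def
        by (auto intro!: derivative_eq_intros simp: algebra_simps)
      then have "(g \<circ> (\<lambda>\<beta>. of_real R * cis \<beta>) has_vector_derivative
          of_real R * (\<i> * cis \<beta>) * deriv g ?w) (at \<beta>)"
        by (rule field_vector_diff_chain_at) (rule g_deriv[OF w])
      from bounded_linear.has_vector_derivative[OF bounded_linear_Im this]
      have "((\<lambda>\<beta>. Im (g (of_real R * cis \<beta>))) has_real_derivative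
          Im (of_real R * (\<i> * cis \<beta>) * deriv g ?w)) (at \<beta>)"
        by (simp add: has_real_derivative_iff_has_vector_derivative o_def)
      moreover have "Im (of_real R * (\<i> * cis \<beta>) * deriv g ?w) = Re (?w * deriv g ?w)"
        by (simp add: algebra_simps)
      ultimately have "((\<lambda>\<beta>. Im (g (of_real R * cis \<beta>))) has_real_derivative
          Re (?w * deriv g ?w)) (at \<beta>)"
        by (simp only:)
      moreover have "((\<lambda>\<beta>. \<beta> / speed) has_real_derivative 1 / speed) (at \<beta>)"
        by (rule DERIV_cdivide[OF DERIV_ident])
      ultimately have "(F has_field_derivative F' \<beta>) (at \<beta>)"
        unfolding F_def F'_def by (rule DERIV_diff)
      then show "(F has_field_derivative F' \<beta>) (at \<beta> within S)"
        by (rule has_field_derivative_at_within)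
      have "F' \<beta> = Re (?w * deriv g ?w - of_real (1 / speed))"
        by (simp only: F'_def minus_complex.simps Re_complex_of_real)
      then have "norm (F' \<beta>) \<le> cmod (?w * deriv g ?w - of_real (1 / speed))"
        by (metis abs_Re_le_cmod real_norm_def)
      also have "\<dots> \<le> d"
        using b[OF _ sec[OF \<beta>]] R1 Rb by (simp add: norm_mult)
      finally show "norm (F' \<beta>) \<le> d" .
    qed (auto simp: S_def)
    also have "\<dots> \<le> d * (pi / 2)"
      using \<alpha> d by (intro mult_left_mono) auto
    also have "\<dots> = e" by (simp add: d_def)
    finally show "\<bar>Im (g (of_real R * cis \<alpha>)) - Im (g (of_real R)) - \<alpha> / speed\<bar> \<le> e"
      by (simp add: F_def algebra_simps)
  qed simp
qed

text \<open>By the intermediate value theorem: the modulus starts at most \<open>R\<close>, and by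
  \<open>Re_flow_ge\<close> it has reached \<open>R\<close> by the time \<open>T\<close>.\<close>

lemma flow_attains_norm:
  assumes c: "0 < speed" and w: "w \<in> half_plane" and R: "cmod w \<le> R"
  obtains t where "0 \<le> t" "cmod (flow t w) = R"
proof -
  define T where "T = R / (speed * Re w)"
  have Rew: "Re w > 0" using w by (simp add: half_plane_iff)
  have T: "0 \<le> T" using c Rew order_trans[OF norm_ge_zero R] by (simp add: T_def)
  have "R \<le> Re w + speed * Re w * T" using c Rew by (simp add: T_def)
  also have "\<dots> \<le> cmod (flow T w)"
    using Re_flow_ge[OF w T] complex_Re_le_cmod[of "flow T w"] by simp
  finally have "R \<le> cmod (flow T w)" .
  moreover have "continuous_on {0..T} (\<lambda>t. cmod (flow t w))"
  proof (intro continuous_intros continuous_at_imp_continuous_on ballI)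
    fix t assume "t \<in> {0..T}"
    then show "isCont (\<lambda>t. flow t w) t"
      using has_vector_derivative_continuous[OF flow_deriv[OF w]] by auto
  qed
  ultimately have "\<exists>t. 0 \<le> t \<and> t \<le> T \<and> cmod (flow t w) = R"
    using R T by (intro IVT') (auto simp: flow_0[OF w])
  then show thesis using that by blast
qed

text \<open>Follow the trajectory of \<open>w\<close>, along which \<open>Im g\<close> is constant,
  until it meets the circle of radius \<open>R\<close>; then compare with the axis along the arc.
  The angle is less than pi / 2, and \<open>M\<close> depends only on \<open>w\<close>.\<close>

lemma Im_g_near_axis:
  assumes c: "0 < speed" and w: "w \<in> half_plane" and e: "0 < e"
  shows "\<forall>\<^sub>F R in at_top. \<bar>Im (g w) - Im (g (of_real R))\<bar> \<le> pi / (2 * speed) + e"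
proof -
  obtain M where M: "\<And>t. 0 \<le> t \<Longrightarrow> flow t w \<in> sector M"
    using flow_in_sector[OF c w] by blast
  obtain R0 where R0: "\<And>R \<alpha>. R \<ge> R0 \<Longrightarrow> \<bar>\<alpha>\<bar> < pi / 2 \<Longrightarrow> 1 \<le> M * cos \<alpha> \<Longrightarrow>
      \<bar>Im (g (of_real R * cis \<alpha>)) - Im (g (of_real R)) - \<alpha> / speed\<bar> \<le> e"
    using Im_g_arc[OF c e, of M] by blast
  have "\<bar>Im (g w) - Im (g (of_real R))\<bar> \<le> pi / (2 * speed) + e"
    if R: "R \<ge> max R0 (cmod w)" for R
  proof -
    obtain t where t: "0 \<le> t" and Rt: "cmod (flow t w) = R"
      using flow_attains_norm[OF c w, of R] R by auto
    define \<alpha> where "\<alpha> = Arg (flow t w)"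
    have pos: "Re (flow t w) > 0" and sec: "cmod (flow t w) \<le> M * Re (flow t w)"
      using M[OF t] by (auto simp: sector_def)
    have eq: "flow t w = of_real R * cis \<alpha>"
      unfolding \<alpha>_def Rt[symmetric] by (metis rcis_cmod_Arg rcis_def)
    have nz: "flow t w \<noteq> 0" using pos by auto
    have \<alpha>: "\<bar>\<alpha>\<bar> < pi / 2"
      unfolding \<alpha>_def Arg_eq_Im_Ln[OF nz] using Re_Ln_pos_lt[OF nz] pos by blast
    have "R > 0" using Rt nz by auto
    have "R \<le> M * (R * cos \<alpha>)" using sec unfolding Rt by (simp add: eq)
    then have "R * 1 \<le> R * (M * cos \<alpha>)" by (simp add: mult_ac)
    then have "1 \<le> M * cos \<alpha>"
      by (rule mult_left_le_imp_le) (rule \<open>R > 0\<close>)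
    moreover have "Im (g w) = Im (g (of_real R * cis \<alpha>))"
      using g_flow[OF w t] by (simp add: eq)
    ultimately have "\<bar>Im (g w) - Im (g (of_real R)) - \<alpha> / speed\<bar> \<le> e"
      using R0[of R \<alpha>] R \<alpha> by simp
    moreover have "\<bar>\<alpha> / speed\<bar> \<le> pi / (2 * speed)"
      using \<alpha> c by (simp add: field_simps)
    ultimately show ?thesis by linarith
  qed
  then show ?thesis unfolding eventually_at_top_linorder by blast
qed

text \<open>At two points of one circle with arguments close to pi / 2 and -pi / 2,
  \<open>Im g\<close> differs from its axis value by almost \<open>pi / (2 * speed)\<close>, once
  upwards and once downwards. Later axis values must stay within about this distance of both, which
  pins them near the middle.\<close>

lemma Im_g_axis_limit:
  assumes c: "0 < speed"
  obtains a where "((\<lambda>R. Im (g (of_real R))) \<longlongrightarrow> a) at_top"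
proof (rule tendsto_at_top_if_almost_constant[of "\<lambda>R. Im (g (of_real R))"])
  fix e :: real assume e: "e > 0"
  \<comment> \<open>The angle missing to pi / 2 costs at most \<open>e / 3\<close> after division by
    \<open>speed\<close>; the maximum with 0 covers large \<open>e\<close>.\<close>
  define \<theta> where "\<theta> = max 0 (pi / 2 - e / 3 * speed)"
  have "0 < e / 3 * speed" using e c by simp
  then have \<theta>: "0 \<le> \<theta>" "\<theta> < pi / 2"
    using pi_gt_zero by (auto simp: \<theta>_def max_def simp del: pi_gt_zero)
  have "pi / 2 - e / 3 * speed \<le> \<theta>" by (simp add: \<theta>_def)
  then have \<theta>_speed: "pi / (2 * speed) \<le> \<theta> / speed + e / 3"
    using c by (simp add: field_simps)
  have cos: "cos \<theta> > 0" using \<theta> by (intro cos_gt_zero_pi) auto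
  have e3: "e / 3 > 0" using e by simp
  obtain R where R: "R > 0" and arc: "\<And>\<alpha>. \<bar>\<alpha>\<bar> < pi / 2 \<Longrightarrow> 1 \<le> 1 / cos \<theta> * cos \<alpha> \<Longrightarrow>
      \<bar>Im (g (of_real R * cis \<alpha>)) - Im (g (of_real R)) - \<alpha> / speed\<bar> \<le> e / 3"
    using Im_g_arc[OF c e3, of "1 / cos \<theta>"] by blast
  have in_hp: "of_real R * cis \<alpha> \<in> half_plane" if "\<alpha> = \<theta> \<or> \<alpha> = - \<theta>" for \<alpha>
    using R cos that by (auto simp: half_plane_iff)
  have up: "\<bar>Im (g (of_real R * cis \<theta>)) - Im (g (of_real R)) - \<theta> / speed\<bar> \<le> e / 3"
    using \<theta> cos by (intro arc) auto
  have down: "\<bar>Im (g (of_real R * cis (- \<theta>))) - Im (g (of_real R)) - (- \<theta>) / speed\<bar> \<le> e / 3"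
    using \<theta> cos by (intro arc) auto
  have "\<forall>\<^sub>F r in at_top. \<bar>Im (g (of_real r)) - Im (g (of_real R))\<bar> \<le> e"
    using Im_g_near_axis[OF c in_hp[OF disjI1[OF refl]] e3]
      Im_g_near_axis[OF c in_hp[OF disjI2[OF refl]] e3]
  proof eventually_elim
    case (elim r)
    then show ?case using up down \<theta>_speed unfolding minus_divide_left[symmetric] by linarith
  qed
  then show "\<exists>y. \<forall>\<^sub>F r in at_top. \<bar>Im (g (of_real r)) - y\<bar> \<le> e" by blast
qed

text \<open>The rays show that \<open>Im g\<close> comes close to every level inside the strip,
  which makes the strip sharp. For each ray the sector with \<open>M = 1 / cos \<alpha>\<close> is
  just wide enough.\<close>

lemma Im_g_ray_limit:
  assumes c: "0 < speed" and a: "((\<lambda>R. Im (g (of_real R))) \<longlongrightarrow> a) at_top" and \<alpha>: "\<bar>\<alpha>\<bar> < pi / 2"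
  shows "((\<lambda>R. Im (g (of_real R * cis \<alpha>))) \<longlongrightarrow> a + \<alpha> / speed) at_top"
proof -
  have cos: "cos \<alpha> > 0" using \<alpha> by (intro cos_gt_zero_pi) auto
  have "((\<lambda>R. Im (g (of_real R * cis \<alpha>)) - Im (g (of_real R))) \<longlongrightarrow> \<alpha> / speed) at_top"
  proof (rule tendstoI)
    fix e :: real assume e: "e > 0"
    then obtain R0 where "\<And>R. R \<ge> R0 \<Longrightarrow>
        \<bar>Im (g (of_real R * cis \<alpha>)) - Im (g (of_real R)) - \<alpha> / speed\<bar> \<le> e / 2"
      using Im_g_arc[OF c, of "e / 2" "1 / cos \<alpha>"] \<alpha> cos by auto
    with e have "dist (Im (g (of_real R * cis \<alpha>)) - Im (g (of_real R))) (\<alpha> / speed) < e"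
      if "R \<ge> R0" for R
      using that by (fastforce simp: dist_real_def)
    then show "\<forall>\<^sub>F R in at_top. dist (Im (g (of_real R * cis \<alpha>)) - Im (g (of_real R))) (\<alpha> / speed) < e"
      by (auto simp: eventually_at_top_linorder)
  qed
  from tendsto_add[OF a this] show ?thesis by simp
qed

lemma Im_g_strip:
  assumes c: "0 < speed" and a: "((\<lambda>R. Im (g (of_real R))) \<longlongrightarrow> a) at_top"
    and w: "w \<in> half_plane"
  shows "\<bar>Im (g w) - a\<bar> < pi / (2 * speed)"
proof -
  have le: "\<bar>Im (g z) - a\<bar> \<le> pi / (2 * speed)" if z: "z \<in> half_plane" for z
  proof (rule field_le_epsilon)
    fix e :: real assume "e > 0"
    show "\<bar>Im (g z) - a\<bar> \<le> pi / (2 * speed) + e"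
      by (rule tendsto_upperbound[OF tendsto_rabs[OF tendsto_diff[OF tendsto_const a]]
            Im_g_near_axis[OF c z \<open>e > 0\<close>]]) simp
  qed
  \<comment> \<open>The range is open, so heights above and below \<open>Im (g w)\<close> are
    attained too; the weak bound there forces the strict one at \<open>w\<close>.\<close>
  obtain r where r: "r > 0" and cball: "cball (g w) r \<subseteq> g ` half_plane"
    using open_range w by (auto simp: open_contains_cball)
  have "\<bar>Im (g w) + s - a\<bar> \<le> pi / (2 * speed)" if "\<bar>s\<bar> = r" for s
  proof -
    have "g w + of_real s * \<i> \<in> g ` half_plane"
      using that by (intro subsetD[OF cball]) (simp add: dist_norm norm_mult)
    then obtain z where "z \<in> half_plane" "g z = g w + of_real s * \<i>" by auto
    then show ?thesis using le[of z] by simp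
  qed
  from this[of r] this[of "- r"] r show ?thesis by linarith
qed

text \<open>The limits along the rays lie between \<open>l\<close> and \<open>u\<close>, and their
  angles may approach pi / 2 and -pi / 2.\<close>

lemma strip_bounds_if_contained:
  assumes c: "0 < speed" and a: "((\<lambda>R. Im (g (of_real R))) \<longlongrightarrow> a) at_top"
    and strip: "\<And>w. w \<in> half_plane \<Longrightarrow> l \<le> Im (g w) \<and> Im (g w) \<le> u"
  shows "l \<le> a - pi / (2 * speed)" "a + pi / (2 * speed) \<le> u"
proof -
  have ray: "l \<le> a + \<alpha> / speed \<and> a + \<alpha> / speed \<le> u" if \<alpha>: "\<bar>\<alpha>\<bar> < pi / 2" for \<alpha>
  proof -
    have "cos \<alpha> > 0" using \<alpha> by (intro cos_gt_zero_pi) auto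
    then have in_hp: "of_real R * cis \<alpha> \<in> half_plane" if "R > 0" for R
      using that by (simp add: half_plane_iff)
    have "\<forall>\<^sub>F R in at_top. l \<le> Im (g (of_real R * cis \<alpha>)) \<and> Im (g (of_real R * cis \<alpha>)) \<le> u"
      using eventually_gt_at_top[of "0::real"] by eventually_elim (intro strip in_hp)
    then have "\<forall>\<^sub>F R in at_top. l \<le> Im (g (of_real R * cis \<alpha>))"
      "\<forall>\<^sub>F R in at_top. Im (g (of_real R * cis \<alpha>)) \<le> u"
      by (simp_all add: eventually_conj_iff)
    then show ?thesis
      using tendsto_lowerbound[OF Im_g_ray_limit[OF c a \<alpha>]]
        tendsto_upperbound[OF Im_g_ray_limit[OF c a \<alpha>]] by simp
  qed
  have ray': "\<alpha> / speed \<le> a - l" "\<alpha> / speed \<le> u - a" if "0 < \<alpha>" "\<alpha> < pi / 2" for \<alpha>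
  proof -
    have "l \<le> a - \<alpha> / speed" using ray[of "- \<alpha>"] that by simp
    then show "\<alpha> / speed \<le> a - l" by linarith
    have "a + \<alpha> / speed \<le> u" using ray[of \<alpha>] that by simp
    then show "\<alpha> / speed \<le> u - a" by linarith
  qed
  have bound: "pi / (2 * speed) \<le> b" if b: "\<And>\<alpha>. 0 < \<alpha> \<Longrightarrow> \<alpha> < pi / 2 \<Longrightarrow> \<alpha> / speed \<le> b" for b
  proof -
    have "pi / 2 \<le> b * speed"
    proof (rule dense_le_bounded)
      show "0 < pi / 2" by simp
      show "\<alpha> \<le> b * speed" if "0 < \<alpha>" "\<alpha> < pi / 2" for \<alpha>
        using b[OF that] c by (simp add: field_simps)
    qed
    then show ?thesis using c by (simp add: field_simps)
  qed
  show "l \<le> a - pi / (2 * speed)"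
    using bound[OF ray'(1)] by linarith
  show "a + pi / (2 * speed) \<le> u"
    using bound[OF ray'(2)] by linarith
qed

section \<open>Derivative bounds and the speed\<close>

lemma norm_deriv_le_if_strip:
  assumes strip: "\<And>w. w \<in> half_plane \<Longrightarrow> l < Im (g w) \<and> Im (g w) < u" and w: "w \<in> half_plane"
  shows "2 * Re w * cmod (deriv g w) \<le> 2 * (u - l) / pi"
proof -
  \<comment> \<open>Scaling by \<open>k\<close> gives the strip width pi, so the exponential of the
    centred map takes values in the right half-plane. In the Schwarz--Pick bound the factor |f w|
    then cancels.\<close>
  define k where "k = pi / (u - l)"
  have ul: "l < u" using strip[OF w] by linarith
  then have k: "k > 0" by (simp add: k_def)
  define f where "f = (\<lambda>w. exp (of_real k * (g w - \<i> * of_real ((l + u) / 2))))"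
  have Df: "(f has_field_derivative of_real k * deriv g z * f z) (at z)" if "z \<in> half_plane" for z
    unfolding f_def by (auto intro!: derivative_eq_intros g_deriv[OF that])
  have "cmod (deriv f w) * Re w \<le> Re (f w)"
  proof (rule Schwarz_Pick_half_plane_deriv[OF _ _ w])
    show "f holomorphic_on half_plane"
      unfolding f_def by (intro holomorphic_intros hol)
    fix z assume z: "z \<in> half_plane"
    define y where "y = Im (g z) - (l + u) / 2"
    have "\<bar>y\<bar> < (u - l) / 2" using strip[OF z] unfolding y_def by (simp only: abs_less_iff) (auto simp: field_simps)
    then have "k * \<bar>y\<bar> < k * ((u - l) / 2)" using k by (rule mult_strict_left_mono)
    also have "\<dots> = pi / 2" using ul by (simp add: k_def)
    finally have "\<bar>k * y\<bar> < pi / 2" using k by (simp add: abs_mult)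
    then have "cos (k * y) > 0" by (intro cos_gt_zero_pi) auto
    then show "0 < Re (f z)" by (simp add: f_def Re_exp y_def)
  qed
  also have "\<dots> \<le> cmod (f w)" by (rule complex_Re_le_cmod)
  also have "deriv f w = of_real k * deriv g w * f w"
    by (rule DERIV_imp_deriv[OF Df[OF w]])
  finally have "(k * cmod (deriv g w) * Re w) * cmod (f w) \<le> 1 * cmod (f w)"
    using k by (simp add: norm_mult mult_ac)
  then have "k * cmod (deriv g w) * Re w \<le> 1"
    by (rule mult_right_le_imp_le) (simp add: f_def)
  then show ?thesis using ul by (simp add: k_def field_simps)
qed

lemma vfield_on_axis: "((\<lambda>x. vfield (of_real x) / of_real x) \<longlongrightarrow> of_real speed) at_top"
proof (rule filterlim_compose[OF tendsto_speed[of 1]])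
  have "\<forall>\<^sub>F x in at_top. complex_of_real x \<in> sector 1"
    using eventually_gt_at_top[of "0::real"] by eventually_elim (simp add: sector_def)
  moreover have "filterlim complex_of_real at_infinity at_top"
    by (rule filterlim_of_real_at_infinity)
  ultimately show "filterlim complex_of_real (inf at_infinity (principal (sector 1))) at_top"
    by (simp add: filterlim_inf filterlim_principal)
qed

text \<open>At points x of the positive axis the real part equals the modulus, so the hypothesis
  reads |vfield x / x| >= 2 / B; this passes to the limit \<open>speed\<close>.\<close>

lemma speed_pos_if_deriv_bounded:
  assumes B: "\<And>w. w \<in> half_plane \<Longrightarrow> 2 * Re w * cmod (deriv g w) \<le> B"
  shows "0 < speed" "2 / speed \<le> B"
proof -
  have one: "1 \<in> half_plane" by (simp add: half_plane_iff)
  have "0 < 2 * Re 1 * cmod (deriv g 1)" using deriv_g_nonzero[OF one] by simp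
  then have Bpos: "B > 0" using B[OF one] by (rule less_le_trans)
  have "2 / B \<le> cmod (of_real speed)"
  proof (rule tendsto_lowerbound[OF tendsto_norm[OF vfield_on_axis]])
    show "\<forall>\<^sub>F x in at_top. 2 / B \<le> cmod (vfield (of_real x) / of_real x)"
      using eventually_gt_at_top[of "0::real"]
    proof eventually_elim
      case (elim x)
      then have x: "of_real x \<in> half_plane" by (simp add: half_plane_iff)
      show ?case
        using B[OF x] elim Bpos deriv_g_nonzero[OF x]
        by (simp add: vfield_def norm_divide norm_mult field_simps)
    qed
  qed simp
  then have le: "2 / B \<le> speed" using speed_nonneg by simp
  moreover have "0 < 2 / B" using Bpos by simp
  ultimately show "0 < speed" by linarith
  then show "2 / speed \<le> B" using le Bpos by (simp add: field_simps)
qed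

end

section \<open>Transfer from the disk\<close>

definition cayley :: "complex \<Rightarrow> complex"
  where "cayley z = (1 + z) / (1 - z)"

definition cayley_inv :: "complex \<Rightarrow> complex"
  where "cayley_inv w = (w - 1) / (w + 1)"

text \<open>This is the Poisson kernel with pole 1; it turns the Bloch weight and the nontangential
  regions into conditions on the real part.\<close>

lemma Re_cayley:
  assumes "z \<noteq> 1"
  shows "Re (cayley z) = (1 - (cmod z)\<^sup>2) / (cmod (1 - z))\<^sup>2"
proof -
  have "cayley z = (1 + z) * cnj (1 - z) / (cmod (1 - z))\<^sup>2"
    unfolding cayley_def by (rule complex_div_cnj)
  moreover have "Re ((1 + z) * cnj (1 - z)) = 1 - (cmod z)\<^sup>2"
    unfolding cmod_power2 by (simp add: algebra_simps power2_eq_square)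
  ultimately show ?thesis by (simp only: Re_divide_of_real)
qed

lemma cayley_in: "z \<in> unit_disk \<Longrightarrow> cayley z \<in> half_plane"
  using Re_cayley[of z] by (cases "z = 1") (auto simp: half_plane_iff power_less_one_iff)

lemma cayley_inv_in:
  assumes "w \<in> half_plane"
  shows "cayley_inv w \<in> unit_disk"
proof -
  have Re: "Re w > 0" using assms by (simp add: half_plane_iff)
  have "(cmod (w - 1))\<^sup>2 < (cmod (w + cnj 1))\<^sup>2"
    using Re by (simp only: cmod_add_cnj_power2) simp
  then have "cmod (w - 1) < cmod (w + 1)" by (simp add: power2_less_imp_less)
  moreover have "w + 1 \<noteq> 0" using add_cnj_nonzero[OF Re, of 1] by simp
  ultimately show ?thesis by (simp add: cayley_inv_def norm_divide)
qed

lemma cayley_cayley_inv: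
  assumes "w \<in> half_plane"
  shows "cayley (cayley_inv w) = w"
proof -
  have nz: "w + 1 \<noteq> 0" using add_cnj_nonzero[of w 1] assms by (simp add: half_plane_iff)
  have "1 + cayley_inv w = 2 * w / (w + 1)" "1 - cayley_inv w = 2 / (w + 1)"
    using nz by (simp_all add: cayley_inv_def field_simps)
  then show ?thesis using nz by (simp add: cayley_def)
qed

lemma cayley_inv_cayley: "z \<in> unit_disk \<Longrightarrow> cayley_inv (cayley z) = z"
  by (cases "z = 1") (simp_all add: cayley_def cayley_inv_def field_simps)

lemma cayley_inv_image: "cayley_inv ` half_plane = unit_disk"
proof
  show "unit_disk \<subseteq> cayley_inv ` half_plane"
    using cayley_inv_cayley cayley_in by (metis image_eqI subsetI)
qed (use cayley_inv_in in blast)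

lemma cayley_inv_has_field_derivative:
  assumes "w + 1 \<noteq> 0"
  shows "(cayley_inv has_field_derivative 2 / (w + 1)\<^sup>2) (at w)"
  unfolding cayley_inv_def
  by (rule derivative_eq_intros refl | use assms in \<open>simp add: power2_eq_square\<close>)+

text \<open>The pole at 1 gives the limit, but \<open>cayley 1\<close> itself is 0 since division by
  zero yields 0; so the value 1 has to be excluded.\<close>

lemma filterlim_cayley_at_infinity:
  assumes "(f \<longlongrightarrow> 1) F" "\<forall>\<^sub>F x in F. f x \<noteq> 1"
  shows "filterlim (\<lambda>x. cayley (f x)) at_infinity F"
proof (rule filterlim_compose[OF _ filterlim_atI[OF assms]])
  show "filterlim cayley at_infinity (at 1)"
    unfolding cayley_def
  proof (rule filterlim_divide_at_infinity)
    show "((\<lambda>z::complex. 1 + z) \<longlongrightarrow> 1 + 1) (at 1)" by (intro tendsto_intros)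
    have "((\<lambda>z::complex. 1 - z) \<longlongrightarrow> 1 - 1) (at 1)" by (intro tendsto_intros)
    then show "filterlim (\<lambda>z::complex. 1 - z) (at 0) (at 1)"
      by (intro filterlim_atI) (auto simp: eventually_at_filter)
  qed simp
qed

text \<open>The bound |1 + z| <= 1 + |z| turns the factor 1 - |z| of the region into the numerator 1
  - |z|^2 of the real part, so the sector has the same \<open>M\<close>.\<close>

lemma filterlim_cayley_nontangential:
  "filterlim cayley (inf at_infinity (principal (sector M)))
     (at 1 within nontangential_region 1 M)"
proof -
  have "cayley z \<in> sector M" if "z \<in> nontangential_region 1 M" for z
  proof -
    have z: "cmod z < 1" and M: "cmod (1 - z) < M * (1 - cmod z)"
      using that by (auto simp: nontangential_region_def)
    have z1: "z \<noteq> 1" using z by auto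
    have "cmod (1 + z) * cmod (1 - z) \<le> (1 + cmod z) * (M * (1 - cmod z))"
      using M norm_triangle_ineq[of 1 z] by (intro mult_mono) auto
    also have "\<dots> = M * (1 - (cmod z)\<^sup>2)"
      by (simp add: algebra_simps power2_eq_square)
    finally have "cmod (1 + z) * cmod (1 - z) / (cmod (1 - z))\<^sup>2
        \<le> M * (1 - (cmod z)\<^sup>2) / (cmod (1 - z))\<^sup>2"
      by (rule divide_right_mono) simp
    moreover have "cmod (cayley z) = cmod (1 + z) * cmod (1 - z) / (cmod (1 - z))\<^sup>2"
      using z1 by (simp add: cayley_def norm_divide power2_eq_square)
    ultimately have "cmod (cayley z) \<le> M * Re (cayley z)"
      by (simp add: Re_cayley[OF z1])
    then show ?thesis
      using cayley_in[of z] z by (simp add: sector_def half_plane_iff)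
  qed
  then have "\<forall>\<^sub>F z in at 1 within nontangential_region 1 M. cayley z \<in> sector M"
    by (auto simp: eventually_at_filter)
  moreover have "filterlim cayley at_infinity (at 1 within nontangential_region 1 M)"
    by (rule filterlim_cayley_at_infinity[of "\<lambda>z. z"])
      (auto simp: eventually_at_filter)
  ultimately show ?thesis by (simp add: filterlim_inf filterlim_principal)
qed

text \<open>The axis beyond 1 corresponds to the radius towards 1, where |1 - r| = 1 - |r|; so
  aperture 2 contains it.\<close>

lemma filterlim_cayley_inv_axis:
  "filterlim (\<lambda>x. cayley_inv (of_real x)) (at 1 within nontangential_region 1 2) at_top"
proof -
  have eq: "cayley_inv (of_real x) = of_real ((x - 1) / (x + 1))" for x
    by (simp add: cayley_inv_def)
  have "((\<lambda>x::real. (x - 1) / (x + 1)) \<longlongrightarrow> 1) at_top" by real_asymp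
  then have lim: "((\<lambda>x. complex_of_real ((x - 1) / (x + 1))) \<longlongrightarrow> of_real 1) at_top"
    by (rule tendsto_of_real)
  have "\<forall>\<^sub>F x in at_top. complex_of_real ((x - 1) / (x + 1)) \<in> nontangential_region 1 2
      \<and> complex_of_real ((x - 1) / (x + 1)) \<noteq> 1"
    using eventually_gt_at_top[of "1::real"]
  proof eventually_elim
    case (elim x)
    define r where "r = (x - 1) / (x + 1)"
    have r: "0 < r" "r < 1" using elim by (auto simp: r_def)
    have "cmod (1 - of_real r) = \<bar>1 - r\<bar>"
      by (metis norm_of_real of_real_1 of_real_diff)
    then show ?case
      unfolding r_def[symmetric] using r by (auto simp: nontangential_region_def)
  qed
  then show ?thesis
    unfolding eq using lim by (auto simp: filterlim_at)
qed

section \<open>The transported map and the equivalences on the disk\<close>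

locale sigma1 =
  fixes h :: "complex \<Rightarrow> complex"
  assumes h: "h \<in> Sigma_1"
begin

definition hp :: "complex \<Rightarrow> complex"
  where "hp w = h (cayley_inv w)"

lemma h_hol: "h holomorphic_on unit_disk" and h_inj: "inj_on h unit_disk"
  using h by (auto simp: Sigma_1_def)

lemma hp_cayley: "z \<in> unit_disk \<Longrightarrow> hp (cayley z) = h z"
  by (simp add: hp_def cayley_inv_cayley)

lemma hp_image: "hp ` half_plane = h ` unit_disk"
  using cayley_inv_image by (auto simp: hp_def[abs_def] image_image[symmetric])

lemma hp_has_field_derivative:
  assumes "w \<in> half_plane"
  shows "(hp has_field_derivative deriv h (cayley_inv w) * (2 / (w + 1)\<^sup>2)) (at w)"
proof -
  have "(h has_field_derivative deriv h (cayley_inv w)) (at (cayley_inv w))"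
    using h_hol cayley_inv_in[OF assms] by (intro holomorphic_derivI) auto
  moreover have "w + 1 \<noteq> 0"
    using add_cnj_nonzero[of w 1] assms by (simp add: half_plane_iff)
  ultimately show ?thesis
    unfolding hp_def[abs_def]
    by (intro DERIV_chain2[where g = cayley_inv] cayley_inv_has_field_derivative)
qed

lemma inv_hp:
  assumes "y \<in> h ` unit_disk"
  shows "inv_into half_plane hp y = cayley (inv_into unit_disk h y)"
proof -
  obtain z where z: "z \<in> unit_disk" "y = h z" using assms by auto
  have "inj_on hp half_plane"
    using h_inj cayley_inv_in cayley_cayley_inv
    unfolding inj_on_def hp_def by metis
  then have "inv_into half_plane hp (hp (cayley z)) = cayley z"
    using cayley_in[OF z(1)] by (rule inv_into_f_f)
  then show ?thesis using z h_inj by (simp add: hp_cayley del: mem_ball)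
qed

text \<open>The inverse of \<open>hp\<close> is the Cayley transform of the inverse of
  \<open>h\<close>, so convergence to 1 in the disk becomes escape to infinity.\<close>

sublocale abel_flow hp
proof
  show "hp holomorphic_on half_plane"
    using hp_has_field_derivative open_half_plane by (auto simp: holomorphic_on_open)
  show "inj_on hp half_plane"
    using h_inj cayley_inv_in cayley_cayley_inv
    unfolding inj_on_def hp_def by metis
next
  fix w assume w: "w \<in> half_plane"
  have shift: "h (cayley_inv w) + complex_of_real t \<in> h ` unit_disk" if "0 \<le> t" for t
    using h cayley_inv_in[OF w] that by (simp add: Sigma_1_def)
  then show "0 \<le> t \<Longrightarrow> hp w + complex_of_real t \<in> hp ` half_plane" for t
    unfolding hp_image by (simp add: hp_def)
  have "((\<lambda>t. inv_into unit_disk h (h (cayley_inv w) + complex_of_real t)) \<longlongrightarrow> 1) at_top"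
    using h cayley_inv_in[OF w] by (simp add: Sigma_1_def)
  moreover have "\<forall>\<^sub>F t in at_top. inv_into unit_disk h (h (cayley_inv w) + complex_of_real t) \<noteq> 1"
    using eventually_ge_at_top[of "0::real"]
  proof eventually_elim
    case (elim t)
    show ?case using inv_into_into[OF shift[OF elim]] by auto
  qed
  ultimately have "filterlim (\<lambda>t. cayley (inv_into unit_disk h (h (cayley_inv w) + complex_of_real t)))
      at_infinity at_top"
    by (rule filterlim_cayley_at_infinity)
  moreover have "\<forall>\<^sub>F t in at_top. cayley (inv_into unit_disk h (h (cayley_inv w) + complex_of_real t))
      = inv_into half_plane hp (hp w + complex_of_real t)"
    using eventually_ge_at_top[of "0::real"]
  proof eventually_elim
    case (elim t)
    show ?case using inv_hp[OF shift[OF elim]] by (simp add: hp_def)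
  qed
  ultimately show "filterlim (\<lambda>t. inv_into half_plane hp (hp w + complex_of_real t)) at_infinity at_top"
    using filterlim_cong by fastforce
qed

lemma deriv_h:
  assumes z: "z \<in> unit_disk"
  shows "deriv h z = deriv hp (cayley z) * 2 / (1 - z)\<^sup>2"
proof -
  have z1: "z \<noteq> 1" using z by auto
  have "deriv hp (cayley z) = deriv h z * (2 / (cayley z + 1)\<^sup>2)"
    using DERIV_imp_deriv[OF hp_has_field_derivative[OF cayley_in[OF z]]]
    by (simp add: cayley_inv_cayley[OF z])
  also have "cayley z + 1 = 2 / (1 - z)"
    using z1 by (simp add: cayley_def field_simps)
  also have "deriv h z * (2 / (2 / (1 - z))\<^sup>2) = deriv h z * (1 - z)\<^sup>2 / 2"
    by (simp add: power_divide)
  finally show ?thesis using z1 by simp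
qed

lemma one_minus_mult_deriv_h:
  assumes z: "z \<in> unit_disk"
  shows "(1 - z) * deriv h z = (cayley z + 1) * deriv hp (cayley z)"
proof -
  have z1: "z \<noteq> 1" using z by auto
  then have "cayley z + 1 = 2 / (1 - z)" by (simp add: cayley_def field_simps)
  then show ?thesis using z1 by (simp add: deriv_h[OF z] power2_eq_square)
qed

text \<open>Conformal invariance of the Bloch density. Comparing finite bounds \<open>B\<close> lets
  the real-valued lemmas on the half-plane be used for the extended-real supremum.\<close>

lemma bloch_seminorm_le_iff:
  "bloch_seminorm h \<le> ereal B \<longleftrightarrow> (\<forall>w\<in>half_plane. 2 * Re w * cmod (deriv hp w) \<le> B)"
proof -
  have eq: "(1 - (cmod z)\<^sup>2) * cmod (deriv h z) = 2 * Re (cayley z) * cmod (deriv hp (cayley z))"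
    if "z \<in> unit_disk" for z
  proof -
    have "z \<noteq> 1" using that by auto
    then show ?thesis
      by (simp add: deriv_h[OF that] Re_cayley norm_mult norm_divide norm_power)
  qed
  have "bloch_seminorm h \<le> ereal B \<longleftrightarrow>
      (\<forall>z\<in>unit_disk. (1 - (cmod z)\<^sup>2) * cmod (deriv h z) \<le> B)"
    by (simp add: bloch_seminorm_def SUP_le_iff)
  also have "\<dots> \<longleftrightarrow> (\<forall>z\<in>unit_disk. 2 * Re (cayley z) * cmod (deriv hp (cayley z)) \<le> B)"
    using eq by auto
  also have "\<dots> \<longleftrightarrow> (\<forall>w\<in>half_plane. 2 * Re w * cmod (deriv hp w) \<le> B)"
    using cayley_in cayley_inv_in cayley_cayley_inv by metis
  finally show ?thesis .
qed

text \<open>The bound \<open>norm_deriv_le\<close> gives one inequality; the other holds because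
  every finite bound \<open>B\<close> already dominates the limit along the axis.\<close>

lemma bloch_seminorm_eq:
  assumes c: "0 < speed"
  shows "bloch_seminorm h = ereal (2 / speed)"
proof (rule antisym)
  have "2 * Re w * cmod (deriv hp w) \<le> 2 / speed" if "w \<in> half_plane" for w
    using norm_deriv_le[OF that] c by (simp add: field_simps)
  then show le: "bloch_seminorm h \<le> ereal (2 / speed)"
    by (simp add: bloch_seminorm_le_iff)
  show "ereal (2 / speed) \<le> bloch_seminorm h"
  proof (rule ereal_le_real)
    fix B assume "bloch_seminorm h \<le> ereal B"
    then show "ereal (2 / speed) \<le> ereal B"
      using speed_pos_if_deriv_bounded(2)[of B] by (simp add: bloch_seminorm_le_iff)
  qed
qed

lemma bloch_function_iff: "bloch_function h \<longleftrightarrow> 0 < speed"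
proof
  assume "bloch_function h"
  then have fin: "bloch_seminorm h < \<infinity>" by (simp add: bloch_function_def)
  obtain B where "bloch_seminorm h \<le> ereal B"
    using fin by (cases "bloch_seminorm h") auto
  then show "0 < speed"
    using speed_pos_if_deriv_bounded(1)[of B] by (simp add: bloch_seminorm_le_iff)
next
  assume "0 < speed"
  then show "bloch_function h" by (simp add: bloch_function_def h_hol bloch_seminorm_eq)
qed

text \<open>On the radius, the product of the quantity tending to \<open>\<mu>\<close> with
  \<open>vfield x / x\<close> is (x + 1) / x. Hence \<open>\<mu> * speed = 1\<close>, which rules
  out speed 0 and shows that \<open>\<mu>\<close> is real.\<close>

lemma angular_limit_imp_speed:
  assumes "has_angular_limit (\<lambda>z. (1 - z) * deriv h z) 1 \<mu>"
  shows "0 < speed" "\<mu> = of_real (1 / speed)"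
proof -
  have "((\<lambda>z. (1 - z) * deriv h z) \<longlongrightarrow> \<mu>) (at 1 within nontangential_region 1 2)"
    using assms by (simp add: has_angular_limit_def)
  from filterlim_compose[OF this filterlim_cayley_inv_axis]
  have "((\<lambda>x. (1 - cayley_inv (of_real x)) * deriv h (cayley_inv (of_real x))) \<longlongrightarrow> \<mu>) at_top" .
  moreover have "\<forall>\<^sub>F x in at_top. (1 - cayley_inv (of_real x)) * deriv h (cayley_inv (of_real x))
      = (of_real x + 1) * deriv hp (of_real x)"
    using eventually_gt_at_top[of "0::real"]
  proof eventually_elim
    case (elim x)
    then have x: "of_real x \<in> half_plane" by (simp add: half_plane_iff)
    show ?case
      using one_minus_mult_deriv_h[OF cayley_inv_in[OF x]] by (simp add: cayley_cayley_inv[OF x])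
  qed
  ultimately have "((\<lambda>x. (of_real x + 1) * deriv hp (of_real x)) \<longlongrightarrow> \<mu>) at_top"
    by (rule Lim_transform_eventually)
  from tendsto_mult[OF this vfield_on_axis]
  have "((\<lambda>x. (of_real x + 1) * deriv hp (of_real x) * (vfield (of_real x) / of_real x))
      \<longlongrightarrow> \<mu> * of_real speed) at_top" .
  moreover have "\<forall>\<^sub>F x in at_top. (of_real x + 1) * deriv hp (of_real x) * (vfield (of_real x) / of_real x)
      = complex_of_real ((x + 1) / x)"
    using eventually_gt_at_top[of "0::real"]
  proof eventually_elim
    case (elim x)
    then have "deriv hp (of_real x) \<noteq> 0"
      by (intro deriv_g_nonzero) (simp add: half_plane_iff)
    then show ?case using elim by (simp add: vfield_def)
  qed
  ultimately have "((\<lambda>x. complex_of_real ((x + 1) / x)) \<longlongrightarrow> \<mu> * of_real speed) at_top"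
    by (rule Lim_transform_eventually)
  moreover have "((\<lambda>x::real. (x + 1) / x) \<longlongrightarrow> 1) at_top" by real_asymp
  then have "((\<lambda>x. complex_of_real ((x + 1) / x)) \<longlongrightarrow> of_real 1) at_top"
    by (rule tendsto_of_real)
  ultimately have eq: "\<mu> * of_real speed = of_real 1"
    by (rule tendsto_unique[rotated]) simp
  then have "speed \<noteq> 0" by auto
  then show "0 < speed" using speed_nonneg by simp
  then show "\<mu> = of_real (1 / speed)" using eq by (simp add: field_simps)
qed

text \<open>The expression becomes \<open>(w + 1) * deriv hp w\<close>, which differs from
  \<open>w * deriv hp w\<close> by the factor 1 + 1 / w tending to 1.\<close>

lemma has_angular_limit_if_speed_pos:
  assumes c: "0 < speed"
  shows "has_angular_limit (\<lambda>z. (1 - z) * deriv h z) 1 (of_real (1 / speed))"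
  unfolding has_angular_limit_def
proof (intro allI impI)
  fix M :: real
  let ?F = "inf at_infinity (principal (sector M))"
  have "filterlim (\<lambda>w. w) at_infinity ?F"
    by (metis filterlim_ident filterlim_mono inf_le1 order_refl)
  then have "((\<lambda>w. 1 / w) \<longlongrightarrow> 0) ?F" by (rule tendsto_divide_0[OF tendsto_const])
  from tendsto_mult[OF tendsto_id_mult_deriv[OF c] tendsto_add[OF tendsto_const[of 1] this]]
  have "((\<lambda>w. w * deriv hp w * (1 + 1 / w)) \<longlongrightarrow> of_real (1 / speed)) ?F" by simp
  then have "((\<lambda>z. cayley z * deriv hp (cayley z) * (1 + 1 / cayley z)) \<longlongrightarrow> of_real (1 / speed))
      (at 1 within nontangential_region 1 M)"
    by (rule filterlim_compose[OF _ filterlim_cayley_nontangential])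
  moreover have "\<forall>\<^sub>F z in at 1 within nontangential_region 1 M.
      cayley z * deriv hp (cayley z) * (1 + 1 / cayley z) = (1 - z) * deriv h z"
    unfolding eventually_at_filter
  proof (intro always_eventually allI impI)
    fix z assume "z \<in> nontangential_region 1 M"
    then have z: "z \<in> unit_disk" by (simp add: nontangential_region_def)
    have "cayley z \<noteq> 0" using cayley_in[OF z] by (auto simp: half_plane_iff)
    then show "cayley z * deriv hp (cayley z) * (1 + 1 / cayley z) = (1 - z) * deriv h z"
      unfolding one_minus_mult_deriv_h[OF z] by (simp add: field_simps)
  qed
  ultimately show "((\<lambda>z. (1 - z) * deriv h z) \<longlongrightarrow> of_real (1 / speed))
      (at 1 within nontangential_region 1 M)"
    by (rule Lim_transform_eventually)
qed

lemma Sigma_A0_1_iff: "h \<in> Sigma_A0_1 \<longleftrightarrow> 0 < speed"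
  using h angular_limit_imp_speed has_angular_limit_if_speed_pos by (auto simp: Sigma_A0_1_def)

text \<open>Both limits are given with the same \<open>a\<close>: the first feeds the strip lemmas,
  and the substitution R = (1 + r) / (1 - r) yields the second.\<close>

lemma Im_h_radial_limit:
  assumes c: "0 < speed"
  obtains a where "((\<lambda>R. Im (hp (of_real R))) \<longlongrightarrow> a) at_top"
    "((\<lambda>r. Im (h (of_real r))) \<longlongrightarrow> a) (at_left 1)"
proof -
  obtain a where a: "((\<lambda>R. Im (hp (of_real R))) \<longlongrightarrow> a) at_top"
    using Im_g_axis_limit[OF c] .
  have "filterlim (\<lambda>r::real. (1 + r) / (1 - r)) at_top (at_left 1)" by real_asymp
  from filterlim_compose[OF a this]
  have "((\<lambda>r. Im (hp (of_real ((1 + r) / (1 - r))))) \<longlongrightarrow> a) (at_left 1)" .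
  moreover have "\<forall>\<^sub>F r in at_left 1. Im (hp (of_real ((1 + r) / (1 - r)))) = Im (h (of_real r))"
  proof -
    have "\<forall>\<^sub>F r in at_left (1::real). r \<in> {0<..<1}"
      by (rule eventually_at_left_real) simp
    then show ?thesis
    proof eventually_elim
      case (elim r)
      then have "hp (cayley (of_real r)) = h (of_real r)" by (intro hp_cayley) simp
      then show ?case by (simp add: cayley_def)
    qed
  qed
  ultimately have "((\<lambda>r. Im (h (of_real r))) \<longlongrightarrow> a) (at_left 1)"
    by (rule Lim_transform_eventually)
  with a show thesis by (rule that)
qed

lemma smallest_strip:
  assumes c: "0 < speed" and a: "((\<lambda>R. Im (hp (of_real R))) \<longlongrightarrow> a) at_top"
  shows "smallest_horizontal_strip_containing (h ` unit_disk)
    {w. \<bar>Im w - a\<bar> < pi / (2 * speed)}" (is "smallest_horizontal_strip_containing _ ?S")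
  unfolding smallest_horizontal_strip_containing_def
proof (intro conjI allI impI)
  have "?S = {w. a - pi / (2 * speed) < Im w \<and> Im w < a + pi / (2 * speed)}"
    by (auto simp: abs_less_iff)
  then show "horizontal_strip ?S" unfolding horizontal_strip_def by blast
  show "h ` unit_disk \<subseteq> ?S"
    unfolding hp_image[symmetric] using Im_g_strip[OF c a] by blast
  fix T assume T: "horizontal_strip T \<and> h ` unit_disk \<subseteq> T"
  then obtain l u where lu: "T = {w. l < Im w \<and> Im w < u}" by (auto simp: horizontal_strip_def)
  have "l \<le> Im (hp w) \<and> Im (hp w) \<le> u" if "w \<in> half_plane" for w
  proof -
    have "hp w \<in> T" using that T hp_image by blast
    then show ?thesis by (simp add: lu)
  qed
  from strip_bounds_if_contained[OF c a this]
  show "?S \<subseteq> T" unfolding lu by (auto simp: abs_less_iff)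
qed

text \<open>One direction uses the explicit strip; conversely, Schwarz--Pick in a strip bounds the
  derivative, and this bound forces positive speed.\<close>

lemma strip_iff: "(\<exists>S. horizontal_strip S \<and> h ` unit_disk \<subseteq> S) \<longleftrightarrow> 0 < speed"
proof
  assume "0 < speed"
  then show "\<exists>S. horizontal_strip S \<and> h ` unit_disk \<subseteq> S"
    using Im_h_radial_limit smallest_strip
    unfolding smallest_horizontal_strip_containing_def by metis
next
  assume "\<exists>S. horizontal_strip S \<and> h ` unit_disk \<subseteq> S"
  then obtain l u where lu: "h ` unit_disk \<subseteq> {w. l < Im w \<and> Im w < u}"
    by (auto simp: horizontal_strip_def)
  have "l < Im (hp w) \<and> Im (hp w) < u" if "w \<in> half_plane" for w
    using that lu unfolding hp_image[symmetric] by blast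
  then show "0 < speed"
    using speed_pos_if_deriv_bounded(1) norm_deriv_le_if_strip by blast
qed

end

theorem theorem7:
  fixes h :: "complex \<Rightarrow> complex"
  assumes "h \<in> Sigma_1"
  shows "(h \<in> Sigma_A0_1 \<longleftrightarrow> (\<exists>S. horizontal_strip S \<and> h ` unit_disk \<subseteq> S)) \<and>
    ((\<exists>S. horizontal_strip S \<and> h ` unit_disk \<subseteq> S) \<longleftrightarrow> bloch_function h) \<and>
    (\<forall>\<mu>. has_angular_limit (\<lambda>z. (1 - z) * deriv h z) 1 \<mu> \<longrightarrow>
       \<mu> \<in> \<real> \<and>
       (\<exists>a::real. ((\<lambda>r::real. Im (h (of_real r))) \<longlongrightarrow> a) (at_left 1) \<and>
          smallest_horizontal_strip_containing (h ` unit_disk)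
            {w. \<bar>Im w - a\<bar> < pi * Re \<mu> / 2}) \<and>
       ereal (2 * norm \<mu>) \<le> bloch_seminorm h \<and>
       bloch_seminorm h \<le> ereal (4 * norm \<mu>))"
proof (intro conjI allI impI)
  interpret sigma1 h using assms by unfold_locales
  show "h \<in> Sigma_A0_1 \<longleftrightarrow> (\<exists>S. horizontal_strip S \<and> h ` unit_disk \<subseteq> S)"
    by (simp only: Sigma_A0_1_iff strip_iff)
  show "(\<exists>S. horizontal_strip S \<and> h ` unit_disk \<subseteq> S) \<longleftrightarrow> bloch_function h"
    by (simp only: bloch_function_iff strip_iff)
  fix \<mu> assume "has_angular_limit (\<lambda>z. (1 - z) * deriv h z) 1 \<mu>"
  then have c: "0 < speed" and \<mu>: "\<mu> = of_real (1 / speed)"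
    by (rule angular_limit_imp_speed)+
  show "\<mu> \<in> \<real>" unfolding \<mu> by (rule Reals_of_real)
  have norm: "norm \<mu> = 1 / speed" unfolding \<mu> norm_of_real using c by simp
  \<comment> \<open>The seminorm equals 2 / speed, so the lower estimate is an equality and the
    upper one holds with a factor 2 to spare.\<close>
  show "ereal (2 * norm \<mu>) \<le> bloch_seminorm h" "bloch_seminorm h \<le> ereal (4 * norm \<mu>)"
    using c by (simp_all add: norm bloch_seminorm_eq field_simps)
  obtain a where "((\<lambda>R. Im (hp (of_real R))) \<longlongrightarrow> a) at_top"
    and radial: "((\<lambda>r. Im (h (of_real r))) \<longlongrightarrow> a) (at_left 1)"
    using Im_h_radial_limit[OF c] .
  from smallest_strip[OF c this(1)]
  have "smallest_horizontal_strip_containing (h ` unit_disk) {w. \<bar>Im w - a\<bar> < pi * Re \<mu> / 2}"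
    by (simp add: \<mu> mult.commute)
  with radial show "\<exists>a::real. ((\<lambda>r::real. Im (h (of_real r))) \<longlongrightarrow> a) (at_left 1) \<and>
      smallest_horizontal_strip_containing (h ` unit_disk) {w. \<bar>Im w - a\<bar> < pi * Re \<mu> / 2}"
    by blast
qed

end
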